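(* Let $d,q\in\mathbb{N}$, let $\mathbb{X}=[0,1]^d$, let $\mathbb{Y}\subset\mathbb{R}^q$ be compact, and let $\mathbb{Z}=\mathbb{X}\times\mathbb{Y}$. Let $f\in\mathcal{F}$ be a conditional probability density function that is continuous on $\mathbb{Z}$, and let $\psi:\mathbb{R}^q\to[0,\infty)$ be a continuous probability density function on $\mathbb{R}^q$. Then: (i) There exists a sequence $\{m_K^\psi\}_{K\in\mathbb{N}}\subset\mathcal{M}_G^\psi$ of Gaussian gated mixture of experts models such that $\lim_{K\to\infty}\Vert f-m_K^\psi\Vert_{p,\mathbb{Z}}=0$ for every $p\in[1,\infty)$. (ii) If $d=1$ (so $\mathbb{X}=[0,1]$), there exists a sequence $\{m_K^\psi\}_{K\in\mathbb{N}}\subset\mathcal{M}_G^\psi$ such that $\lim_{K\to\infty}m_K^\psi=f$ almost uniformly on $\mathbb{Z}$; that is, for every $\delta>0$ there exists a measurable set $\mathbb{E}_\delta\subset\mathbb{Z}$ with $\lambda(\mathbb{E}_\delta)<\delta$ such that $\{m_K^\psi\}_{K\in\mathbb{N}}$ converges to $f$ uniformly on $\mathbb{Z}\setminus\mathbb{E}_\delta$.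
   Context: $\lambda$ denotes Lebesgue measure (on the space of the relevant dimension), and $[K]=\{1,\dots,K\}$. The class of conditional PDFs is $$\mathcal{F}=\left\{f:\mathbb{Z}\to[0,\infty)\ \Big|\ \int_{\mathbb{Y}}f(\boldsymbol{y}|\boldsymbol{x})\,\mathrm{d}\lambda(\boldsymbol{y})=1\ \text{for all }\boldsymbol{x}\in\mathbb{X}\right\},$$ where $f(\boldsymbol{y}|\boldsymbol{x})$ denotes the value of $f$ at $(\boldsymbol{x},\boldsymbol{y})\in\mathbb{Z}$. For $p\in[1,\infty)$, $\Vert f\Vert_{p,\mathbb{Z}}=\left(\int_{\mathbb{Z}}|f|^p\,\mathrm{d}\lambda\right)^{1/p}$. $\mathcal{L}_\infty$ is the class of essentially bounded functions. A PDF $\psi$ on $\mathbb{R}^q$ is a function $\psi:\mathbb{R}^q\to[0,\infty)$ with $\int_{\mathbb{R}^q}\psi\,\mathrm{d}\lambda=1$. The location-scale class generated by $\psi$ is the class $\mathcal{E}_\psi$ of functions $g_\psi(\cdot;\boldsymbol{\mu},\sigma):\mathbb{Y}\to[0,\infty)$, $g_\psi(\boldsymbol{y};\boldsymbol{\mu},\sigma)=\sigma^{-q}\psi\left((\boldsymbol{y}-\boldsymbol{\mu})/\sigma\right)$, with $\boldsymbol{\mu}\in\mathbb{R}^q$, $\sigma\in(0,\infty)$. Let $\mathbb{S}_d$ be the set of $d\times d$ symmetric positive definite matrices, let $\Pi_{K-1}=\{(\pi_k)_{k\in[K]}\,|\,\pi_k>0\ \forall k\in[K],\ \sum_{k=1}^K\pi_k=1\}$,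 and let $$\phi(\boldsymbol{x};\boldsymbol{\nu},\boldsymbol{\Sigma})=|2\pi\boldsymbol{\Sigma}|^{-1/2}\exp\left[-\tfrac12(\boldsymbol{x}-\boldsymbol{\nu})^\top\boldsymbol{\Sigma}^{-1}(\boldsymbol{x}-\boldsymbol{\nu})\right]$$ be the multivariate normal density. The Gaussian gating class $\mathcal{G}_G^K$ is the set of all vectors $\mathbf{Gate}=(\mathrm{Gate}_k)_{k\in[K]}$ of functions on $\mathbb{X}$ of the form $$\mathrm{Gate}_k(\boldsymbol{x})=\frac{\pi_k\phi(\boldsymbol{x};\boldsymbol{\nu}_k,\boldsymbol{\Sigma}_k)}{\sum_{l=1}^K\pi_l\phi(\boldsymbol{x};\boldsymbol{\nu}_l,\boldsymbol{\Sigma}_l)},\qquad k\in[K],$$ with $(\pi_k)_{k\in[K]}\in\Pi_{K-1}$, $\boldsymbol{\nu}_1,\dots,\boldsymbol{\nu}_K\in\mathbb{R}^d$ and $\boldsymbol{\Sigma}_1,\dots,\boldsymbol{\Sigma}_K\in\mathbb{S}_d$. The class $\mathcal{M}_G^\psi$ of Gaussian gated mixture of experts models is the set of all functions $m:\mathbb{Z}\to[0,\infty)$ of the form $$m(\boldsymbol{y}|\boldsymbol{x})=\sum_{k=1}^K\mathrm{Gate}_k(\boldsymbol{x})\,g_\psi(\boldsymbol{y};\boldsymbol{\mu}_k,\sigma_k),$$ with $K\in\mathbb{N}$, $\mathbf{Gate}\in\mathcal{G}_G^K$, $\boldsymbol{\mu}_k\in\mathbb{Y}$, $\sigma_k\in(0,\infty)$,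 and $g_\psi(\cdot;\boldsymbol{\mu}_k,\sigma_k)\in\mathcal{E}_\psi\cap\mathcal{L}_\infty$ for $k\in[K]$. *)

theory Defs
  imports "HOL-Analysis.Analysis"
begin

text \<open>
  A function on a subset of a Euclidean space is represented by a total function; only its values
  on that subset are constrained or used. The dimensions \<open>d\<close> and \<open>q\<close> are \<open>CARD('d)\<close> and
  \<open>CARD('q)\<close>, and the value \<open>f(y|x)\<close> is \<open>f (x, y)\<close>.
\<close>

abbreviation unit_cube :: "(real^'d) set"
  where "unit_cube \<equiv> cbox 0 1"

text \<open>
  The Bochner integral of a non-integrable function is \<open>0\<close>, so an integral equal to \<open>1\<close>
  includes measurability and integrability in the next two definitions.
\<close>

definition pdf :: "(real^'q \<Rightarrow> real) \<Rightarrow> bool"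
  where "pdf \<psi> \<longleftrightarrow> (\<forall>y. 0 \<le> \<psi> y) \<and> (LINT y|lebesgue. \<psi> y) = 1"

definition conditional_pdfs ::
    "(real^'d) set \<Rightarrow> (real^'q) set \<Rightarrow> ((real^'d) \<times> (real^'q) \<Rightarrow> real) set"
  where "conditional_pdfs X Y =
    {f. (\<forall>z\<in>X \<times> Y. 0 \<le> f z) \<and> (\<forall>x\<in>X. (LINT y|lebesgue_on Y. f (x, y)) = 1)}"

text \<open>Infinite, rather than \<open>0\<close>, when \<open>\<bar>f\<bar>\<^sup>p\<close> is not integrable.\<close>

definition Lp_norm :: "real \<Rightarrow> 'a::euclidean_space set \<Rightarrow> ('a \<Rightarrow> real) \<Rightarrow> ennreal"
  where "Lp_norm p S f =
    (if integrable (lebesgue_on S) (\<lambda>z. \<bar>f z\<bar> powr p)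
     then ennreal ((LINT z|lebesgue_on S. \<bar>f z\<bar> powr p) powr (1 / p))
     else \<infinity>)"

definition L_infinity :: "'a::euclidean_space set \<Rightarrow> ('a \<Rightarrow> real) set"
  where "L_infinity S =
    {g. g \<in> borel_measurable (lebesgue_on S) \<and> (\<exists>C. AE y in lebesgue_on S. \<bar>g y\<bar> \<le> C)}"

definition location_scale ::
    "(real^'q \<Rightarrow> real) \<Rightarrow> real^'q \<Rightarrow> real \<Rightarrow> real^'q \<Rightarrow> real"
  where "location_scale \<psi> \<mu> \<sigma> y = (1 / \<sigma> ^ CARD('q)) * \<psi> ((1 / \<sigma>) *\<^sub>R (y - \<mu>))"

definition location_scale_class :: "(real^'q \<Rightarrow> real) \<Rightarrow> (real^'q \<Rightarrow> real) set"
  where "location_scale_class \<psi> = {location_scale \<psi> \<mu> \<sigma> | \<mu> \<sigma>. 0 < \<sigma>}"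

definition sym_pos_def :: "(real^'d^'d) set"
  where "sym_pos_def = {S. transpose S = S \<and> (\<forall>x. x \<noteq> 0 \<longrightarrow> 0 < x \<bullet> (S *v x))}"

definition weight_simplex :: "nat \<Rightarrow> (nat \<Rightarrow> real) set"
  where "weight_simplex K = {w. (\<forall>k\<in>{1..K}. 0 < w k) \<and> (\<Sum>k=1..K. w k) = 1}"

definition gaussian_density :: "real^'d \<Rightarrow> real^'d^'d \<Rightarrow> real^'d \<Rightarrow> real"
  where "gaussian_density \<nu> S x =
    det ((2 * pi) *\<^sub>R S) powr (- 1 / 2) * exp (- (1 / 2) * ((x - \<nu>) \<bullet> (matrix_inv S *v (x - \<nu>))))"

definition gaussian_gates :: "(real^'d) set \<Rightarrow> nat \<Rightarrow> (nat \<Rightarrow> real^'d \<Rightarrow> real) set"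
  where "gaussian_gates X K =
    {gate. \<exists>w \<nu> S. w \<in> weight_simplex K \<and> (\<forall>k\<in>{1..K}. S k \<in> sym_pos_def) \<and>
       (\<forall>k\<in>{1..K}. \<forall>x\<in>X. gate k x =
          w k * gaussian_density (\<nu> k) (S k) x /
            (\<Sum>l=1..K. w l * gaussian_density (\<nu> l) (S l) x))}"

text \<open>
  Essential boundedness of the experts is taken over \<open>Y\<close>, the domain of the functions in the
  location-scale class: a continuous density on \<open>real^'q\<close> need not be bounded there.
\<close>

definition gaussian_gated_moe ::
    "(real^'d) set \<Rightarrow> (real^'q) set \<Rightarrow> (real^'q \<Rightarrow> real) \<Rightarrow> ((real^'d) \<times> (real^'q) \<Rightarrow> real) set"
  where "gaussian_gated_moe X Y \<psi> =
    {m. \<exists>K gate \<mu> \<sigma>. 1 \<le> K \<and> gate \<in> gaussian_gates X K \<and>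
       (\<forall>k\<in>{1..K}. \<mu> k \<in> Y \<and> 0 < \<sigma> k \<and>
          location_scale \<psi> (\<mu> k) (\<sigma> k) \<in> location_scale_class \<psi> \<inter> L_infinity Y) \<and>
       (\<forall>x\<in>X. \<forall>y\<in>Y. m (x, y) = (\<Sum>k=1..K. gate k x * location_scale \<psi> (\<mu> k) (\<sigma> k) y))}"

definition almost_uniform_limit ::
    "'a::euclidean_space set \<Rightarrow> (nat \<Rightarrow> 'a \<Rightarrow> real) \<Rightarrow> ('a \<Rightarrow> real) \<Rightarrow> bool"
  where "almost_uniform_limit Z m f \<longleftrightarrow>
    (\<forall>\<delta>>0. \<exists>E. E \<in> sets lebesgue \<and> E \<subseteq> Z \<and> emeasure lebesgue E < ennreal \<delta> \<and>
       uniform_limit (Z - E) m f sequentially)"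

end

theory Submission
  imports Defs
begin

text \<open>
  Softmax weights \<open>s\<^sub>\<nu>(x) \<propto> exp (- t * norm (x - \<nu>)\<^sup>2)\<close> over a fine finite net of \<open>X\<close>
  concentrate near \<open>x\<close> as \<open>t\<close> grows, so \<open>\<Sum>\<nu>. s\<^sub>\<nu>(x) f(\<nu>, y)\<close> is uniformly close to \<open>f(x, y)\<close>.
  It remains to replace each of the finitely many slices \<open>f(\<nu>, \<cdot>)\<close> by a location-scale mixture with
  centres in \<open>Y\<close>, boundedly and with small error in \<open>L\<^sup>1(Y)\<close>: extend the slice by zero, convolve
  it with the rescaled \<open>\<psi>\<close>, and discretise the convolution. The zero extension is discontinuous,
  but \<open>Y\<close> and its small translates differ by small measure. As the errors stay bounded,
  convergence in \<open>L\<^sup>1\<close> gives convergence in every \<open>L\<^sup>p\<close>; at a geometric rate it is almost uniform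
  by Borel--Cantelli, in every dimension \<open>d\<close>.
\<close>

subsection \<open>Gaussian gates\<close>

text \<open>These are the Gaussian gates with equal weights and common covariance
  \<open>I / (2 * t)\<close>, indexed by their centres; \<open>t\<close> acts as an inverse
  temperature.\<close>

definition softmax :: "real \<Rightarrow> 'a::real_normed_vector set \<Rightarrow> 'a \<Rightarrow> 'a \<Rightarrow> real"
  where "softmax t N \<nu> x =
    exp (- (t * (norm (x - \<nu>))\<^sup>2)) / (\<Sum>n\<in>N. exp (- (t * (norm (x - n))\<^sup>2)))"

lemma softmax_nonneg: "0 \<le> softmax t N \<nu> x"
  by (simp add: softmax_def sum_nonneg)

lemma sum_softmax:
  assumes "finite N" "N \<noteq> {}"
  shows "(\<Sum>\<nu>\<in>N. softmax t N \<nu> x) = 1"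
proof -
  have "(\<Sum>n\<in>N. exp (- (t * (norm (x - n))\<^sup>2))) > 0"
    using assms by (intro sum_pos) auto
  then show ?thesis
    by (simp add: softmax_def flip: sum_divide_distrib)
qed

lemma continuous_on_softmax:
  assumes "finite N" "N \<noteq> {}"
  shows "continuous_on A (softmax t N \<nu>)"
proof -
  have "(\<Sum>n\<in>N. exp (- (t * (norm (x - n))\<^sup>2))) \<noteq> 0" for x
    using assms by (intro less_imp_neq[symmetric] sum_pos) auto
  then show ?thesis
    unfolding softmax_def by (intro continuous_intros) auto
qed

text \<open>One centre \<open>n\<close> near \<open>x\<close> already makes the denominator at least
  \<open>exp (- (t * (\<delta> / 2)\<^sup>2))\<close>, while the numerator is at most
  \<open>exp (- (t * \<delta>\<^sup>2))\<close>; the factor 3/4 is 1 - 1/4.\<close>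

lemma softmax_far:
  assumes "finite N" "n \<in> N" "0 \<le> t" "norm (x - n) \<le> \<delta> / 2" "0 \<le> \<delta>" "\<delta> \<le> norm (x - \<nu>)"
  shows "softmax t N \<nu> x \<le> exp (- (t * (3 / 4 * \<delta>\<^sup>2)))"
proof -
  have "exp (- (t * (\<delta> / 2)\<^sup>2)) \<le> exp (- (t * (norm (x - n))\<^sup>2))"
    using assms by (simp add: mult_left_mono power_mono)
  also have "\<dots> \<le> (\<Sum>n\<in>N. exp (- (t * (norm (x - n))\<^sup>2)))"
    using assms by (intro member_le_sum) auto
  finally have denom: "exp (- (t * (\<delta> / 2)\<^sup>2)) \<le> (\<Sum>n\<in>N. exp (- (t * (norm (x - n))\<^sup>2)))" .
  have "exp (- (t * (norm (x - \<nu>))\<^sup>2)) \<le> exp (- (t * \<delta>\<^sup>2))"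
    using assms by (simp add: mult_left_mono power_mono)
  then have "softmax t N \<nu> x \<le> exp (- (t * \<delta>\<^sup>2)) / exp (- (t * (\<delta> / 2)\<^sup>2))"
    unfolding softmax_def using denom by (intro frac_le) auto
  also have "\<dots> = exp (- (t * (3 / 4 * \<delta>\<^sup>2)))"
    unfolding exp_diff[symmetric] by (simp add: field_simps power2_eq_square)
  finally show ?thesis .
qed

text \<open>Centres within \<open>\<delta>\<close> of \<open>x\<close> contribute values close to
  \<open>f (x, y)\<close> by uniform continuity, and the total weight of the other centres tends to
  zero as \<open>t\<close> grows. The net is fixed before \<open>t\<close>, because the choice of
  \<open>t\<close> depends on \<open>card N\<close>.\<close>

lemma softmax_approximation:
  fixes f :: "'a::euclidean_space \<times> 'b::euclidean_space \<Rightarrow> real"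
  assumes "compact X" "X \<noteq> {}" "compact Y" "continuous_on (X \<times> Y) f" "0 < \<epsilon>"
  obtains N t where "finite N" "N \<noteq> {}" "N \<subseteq> X" "0 < t"
    "\<And>x y. x \<in> X \<Longrightarrow> y \<in> Y \<Longrightarrow> \<bar>(\<Sum>\<nu>\<in>N. softmax t N \<nu> x * f (\<nu>, y)) - f (x, y)\<bar> \<le> \<epsilon>"
proof -
  have compact: "compact (X \<times> Y)"
    using assms by (intro compact_Times)
  then have "uniformly_continuous_on (X \<times> Y) f"
    using assms compact_uniformly_continuous by blast
  then obtain \<delta> where \<delta>: "0 < \<delta>"
      "\<And>z z'. z \<in> X \<times> Y \<Longrightarrow> z' \<in> X \<times> Y \<Longrightarrow> dist z' z < \<delta> \<Longrightarrow> dist (f z') (f z) < \<epsilon> / 2"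
    using \<open>0 < \<epsilon>\<close> unfolding uniformly_continuous_on_def by (meson half_gt_zero)
  have "bounded (f ` (X \<times> Y))"
    using compact assms by (intro compact_imp_bounded compact_continuous_image)
  then obtain B where B: "0 < B" "\<And>z. z \<in> X \<times> Y \<Longrightarrow> \<bar>f z\<bar> \<le> B"
    unfolding bounded_pos by auto
  \<comment> \<open>The radius \<open>\<delta> / 2\<close> supplies, for every \<open>x\<close> in
    \<open>X\<close>, the near centre that \<open>softmax_far\<close> asks for.\<close>
  obtain N where N: "N \<subseteq> X" "finite N" "X \<subseteq> (\<Union>n\<in>N. ball n (\<delta> / 2))"
    using compactE_image[OF \<open>compact X\<close>, of X "\<lambda>n. ball n (\<delta> / 2)"] \<delta>(1) by force
  have "N \<noteq> {}"
    using N(3) \<open>X \<noteq> {}\<close> by auto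
  have "0 < 3 / 4 * \<delta>\<^sup>2"
    using \<delta>(1) by simp
  then have "filterlim (\<lambda>t. t * (3 / 4 * \<delta>\<^sup>2)) at_top at_top"
    by (intro filterlim_at_top_mult_tendsto_pos[OF tendsto_const _ filterlim_ident])
  then have "((\<lambda>t. exp (- (t * (3 / 4 * \<delta>\<^sup>2)))) \<longlongrightarrow> 0) at_top"
    by (intro filterlim_compose[OF exp_at_bot] filterlim_uminus_at_bot_at_top[THEN filterlim_compose])
  then have "((\<lambda>t. card N * (exp (- (t * (3 / 4 * \<delta>\<^sup>2))) * (2 * B))) \<longlongrightarrow> 0) at_top"
    by (intro tendsto_mult_right_zero tendsto_mult_left_zero)
  then have "\<forall>\<^sub>F t in at_top. card N * (exp (- (t * (3 / 4 * \<delta>\<^sup>2))) * (2 * B)) < \<epsilon> / 2"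
    using \<open>0 < \<epsilon>\<close> by (intro order_tendstoD(2)) auto
  then obtain t where t: "0 < t" "card N * (exp (- (t * (3 / 4 * \<delta>\<^sup>2))) * (2 * B)) < \<epsilon> / 2"
    using eventually_happens[OF eventually_conj[OF _ eventually_gt_at_top[of 0]]] by auto
  show thesis
  proof (rule that[OF N(2) \<open>N \<noteq> {}\<close> N(1) t(1)])
    fix x y assume xy: "x \<in> X" "y \<in> Y"
    obtain n where n: "n \<in> N" "norm (x - n) \<le> \<delta> / 2"
      using N(3) xy(1) by (auto simp: dist_norm norm_minus_commute less_imp_le)
    \<comment> \<open>Near and far centres get one common bound, the sum of the two separate ones;
      this spares splitting the sum over the net.\<close>
    have summand: "softmax t N \<nu> x * \<bar>f (\<nu>, y) - f (x, y)\<bar>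
        \<le> softmax t N \<nu> x * (\<epsilon> / 2) + exp (- (t * (3 / 4 * \<delta>\<^sup>2))) * (2 * B)"
      if "\<nu> \<in> N" for \<nu>
    proof (cases "norm (x - \<nu>) < \<delta>")
      case True
      have "dist (f (\<nu>, y)) (f (x, y)) < \<epsilon> / 2"
        using True that xy N(1)
        by (intro \<delta>(2)) (auto simp: dist_Pair_Pair dist_norm norm_minus_commute)
      then have "softmax t N \<nu> x * \<bar>f (\<nu>, y) - f (x, y)\<bar> \<le> softmax t N \<nu> x * (\<epsilon> / 2)"
        by (intro mult_left_mono softmax_nonneg) (simp add: dist_real_def)
      then show ?thesis
        using B(1) by (simp add: add_increasing2)
    next
      case False
      have "\<bar>f (\<nu>, y)\<bar> \<le> B" "\<bar>f (x, y)\<bar> \<le> B"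
        using B(2) xy that N(1) by auto
      then have "softmax t N \<nu> x * \<bar>f (\<nu>, y) - f (x, y)\<bar>
          \<le> exp (- (t * (3 / 4 * \<delta>\<^sup>2))) * (2 * B)"
        using False \<delta>(1) t(1) n N(2) by (intro mult_mono softmax_far) auto
      then show ?thesis
        using softmax_nonneg[of t N \<nu> x] \<open>0 < \<epsilon>\<close> by (simp add: add_increasing)
    qed
    have "(\<Sum>\<nu>\<in>N. softmax t N \<nu> x * f (\<nu>, y)) - f (x, y)
        = (\<Sum>\<nu>\<in>N. softmax t N \<nu> x * (f (\<nu>, y) - f (x, y)))"
      using sum_softmax[OF N(2) \<open>N \<noteq> {}\<close>, of t x]
      by (simp add: right_diff_distrib sum_subtractf flip: sum_distrib_right)
    also have "\<bar>\<dots>\<bar> \<le> (\<Sum>\<nu>\<in>N. softmax t N \<nu> x * \<bar>f (\<nu>, y) - f (x, y)\<bar>)"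
      by (rule order_trans[OF sum_abs]) (simp add: abs_mult softmax_nonneg)
    also have "\<dots> \<le> (\<Sum>\<nu>\<in>N. softmax t N \<nu> x * (\<epsilon> / 2) + exp (- (t * (3 / 4 * \<delta>\<^sup>2))) * (2 * B))"
      by (intro sum_mono summand)
    also have "\<dots> = \<epsilon> / 2 + card N * (exp (- (t * (3 / 4 * \<delta>\<^sup>2))) * (2 * B))"
      using sum_softmax[OF N(2) \<open>N \<noteq> {}\<close>, of t x]
      by (simp add: sum.distrib flip: sum_distrib_right sum_divide_distrib)
    finally show "\<bar>(\<Sum>\<nu>\<in>N. softmax t N \<nu> x * f (\<nu>, y)) - f (x, y)\<bar> \<le> \<epsilon>"
      using t(2) by linarith
  qed
qed

section \<open>Continuity and essential boundedness of the experts\<close>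

lemma continuous_location_scale:
  assumes "continuous_on UNIV \<psi>"
  shows "continuous_on A (\<lambda>z. location_scale \<psi> (fst z) \<sigma> (snd z))"
  unfolding location_scale_def
  by (intro continuous_intros continuous_on_compose2[OF assms]) auto

lemma continuous_location_scale_snd:
  assumes "continuous_on UNIV \<psi>"
  shows "continuous_on A (location_scale \<psi> \<mu> \<sigma>)"
  unfolding location_scale_def
  by (intro continuous_intros continuous_on_compose2[OF assms]) auto

lemma continuous_on_compact_L_infinity:
  fixes g :: "'a::euclidean_space \<Rightarrow> real"
  assumes "compact Y" "continuous_on Y g"
  shows "g \<in> L_infinity Y"
proof -
  have "Y \<in> sets lebesgue"
    using assms(1) lmeasurable_compact by blast
  have "bounded (g ` Y)"
    using assms by (intro compact_imp_bounded compact_continuous_image)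
  then obtain C where "\<And>y. y \<in> Y \<Longrightarrow> \<bar>g y\<bar> \<le> C"
    unfolding bounded_iff by auto
  then have "AE y in lebesgue_on Y. \<bar>g y\<bar> \<le> C"
    by (intro AE_I2) simp
  moreover have "g \<in> borel_measurable (lebesgue_on Y)"
    using assms(2) \<open>Y \<in> sets lebesgue\<close> by (rule continuous_imp_measurable_on_sets_lebesgue)
  ultimately show ?thesis
    unfolding L_infinity_def by blast
qed

section \<open>Scalar covariance matrices and membership in the model class\<close>

lemma mat_vector_mult: "mat c *v x = c *\<^sub>R (x :: real^'n)"
  by (simp add: vec_eq_iff matrix_vector_mult_def mat_def if_distrib[of "\<lambda>a. a * _"] cong: if_cong)

lemma sym_pos_def_mat:
  assumes "0 < c"
  shows "mat c \<in> sym_pos_def"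
  using assms by (simp add: sym_pos_def_def transpose_mat mat_vector_mult)

lemma mat_mult_mat: "mat a ** mat b = (mat (a * b) :: real^'n^'n)"
  by (simp add: matrix_eq mat_vector_mult flip: matrix_vector_mul_assoc)

lemma matrix_inv_mat:
  assumes "c \<noteq> 0"
  shows "matrix_inv (mat c :: real^'n^'n) = mat (inverse c)"
proof -
  let ?C = "mat c :: real^'n^'n"
  \<comment> \<open>\<open>matrix_inv\<close> is a Hilbert choice, so an inverse must be exhibited
    before its defining property is available. Multiplying on the left by
    \<open>mat (inverse c)\<close> then identifies it.\<close>
  have "\<exists>B. ?C ** B = mat 1 \<and> B ** ?C = mat 1"
    using assms by (intro exI[of _ "mat (inverse c)"]) (simp add: mat_mult_mat)
  then have inv: "?C ** matrix_inv ?C = mat 1"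
    unfolding matrix_inv_def by (metis (mono_tags, lifting) someI_ex)
  have "matrix_inv ?C = (mat (inverse c) ** ?C) ** matrix_inv ?C"
    using assms by (simp add: mat_mult_mat)
  also have "\<dots> = mat (inverse c)"
    by (simp add: inv flip: matrix_mul_assoc)
  finally show ?thesis .
qed

text \<open>The inverse covariance is \<open>2 * t\<close> times the identity, which turns the
  quadratic form into a multiple of the squared norm. It matters that \<open>c\<close> is the same
  for all centres and points, so that it cancels in a quotient.\<close>

lemma gaussian_density_scaled_identity:
  fixes \<nu> :: "real^'d"
  assumes "0 < t"
  obtains c where "0 < c"
    "\<And>\<nu> x :: real^'d. gaussian_density \<nu> (mat (1 / (2 * t))) x = c * exp (- (t * (norm (x - \<nu>))\<^sup>2))"
proof
  let ?S = "mat (1 / (2 * t)) :: real^'d^'d"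
  have "(2 * pi) *\<^sub>R ?S = mat (pi / t)"
    by (simp add: vec_eq_iff mat_def)
  then have "det ((2 * pi) *\<^sub>R ?S) = (pi / t) ^ CARD('d)"
    by (simp add: det_diagonal mat_def)
  then show "0 < det ((2 * pi) *\<^sub>R ?S) powr (- 1 / 2)"
    using assms by simp
  show "gaussian_density \<nu> ?S x
      = det ((2 * pi) *\<^sub>R ?S) powr (- 1 / 2) * exp (- (t * (norm (x - \<nu>))\<^sup>2))" for \<nu> x
    using assms by (simp add: gaussian_density_def matrix_inv_mat mat_vector_mult power2_norm_eq_inner)
qed

text \<open>Equal covariances \<open>I / (2 * t)\<close> let the normalising constants cancel in the gates.\<close>

lemma gaussian_gated_moe_finite_index:
  fixes \<psi> :: "real^'q \<Rightarrow> real" and \<nu> :: "'i \<Rightarrow> real^'d"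
  assumes "compact Y" "continuous_on UNIV \<psi>" "finite I" "0 < t"
    and w: "\<And>i. i \<in> I \<Longrightarrow> 0 < w i" "(\<Sum>i\<in>I. w i) = 1"
    and \<mu>: "\<And>i. i \<in> I \<Longrightarrow> \<mu> i \<in> Y" and \<sigma>: "\<And>i. i \<in> I \<Longrightarrow> 0 < \<sigma> i"
    and m: "\<And>x y. x \<in> X \<Longrightarrow> y \<in> Y \<Longrightarrow> m (x, y) =
      (\<Sum>i\<in>I. w i * exp (- (t * (norm (x - \<nu> i))\<^sup>2)) /
         (\<Sum>j\<in>I. w j * exp (- (t * (norm (x - \<nu> j))\<^sup>2))) * location_scale \<psi> (\<mu> i) (\<sigma> i) y)"
  shows "m \<in> gaussian_gated_moe X Y \<psi>"
proof -
  let ?K = "card I"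
  \<comment> \<open>The model class numbers its components from 1 to K; this bijection carries the
    numbering over to \<open>I\<close>.\<close>
  obtain h where h: "bij_betw h {1..?K} I"
    using ex_bij_betw_nat_finite_1[OF \<open>finite I\<close>] by auto
  have reindex: "(\<Sum>k=1..?K. F (h k)) = (\<Sum>i\<in>I. F i)" for F :: "'i \<Rightarrow> real"
    by (rule sum.reindex_bij_betw[OF h])
  have hI: "h k \<in> I" if "k \<in> {1..?K}" for k
    using bij_betwE[OF h] that by blast
  have "I \<noteq> {}"
    using w(2) by auto
  then have "1 \<le> ?K"
    using \<open>finite I\<close> by (simp add: Suc_le_eq card_gt_0_iff)
  let ?S = "mat (1 / (2 * t)) :: real^'d^'d"
  obtain c where c: "0 < c"
    "\<And>\<nu> x :: real^'d. gaussian_density \<nu> ?S x = c * exp (- (t * (norm (x - \<nu>))\<^sup>2))"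
    using gaussian_density_scaled_identity[OF \<open>0 < t\<close>, where 'd='d] by blast
  define gate where "gate k x = w (h k) * gaussian_density (\<nu> (h k)) ?S x /
      (\<Sum>l=1..?K. w (h l) * gaussian_density (\<nu> (h l)) ?S x)" for k x
  have gate_eq: "gate k x = w (h k) * exp (- (t * (norm (x - \<nu> (h k)))\<^sup>2)) /
      (\<Sum>j\<in>I. w j * exp (- (t * (norm (x - \<nu> j))\<^sup>2)))" for k x
    using c(1) reindex[of "\<lambda>i. w i * gaussian_density (\<nu> i) ?S x"]
    by (simp add: gate_def c(2) mult.left_commute[of _ c] flip: sum_distrib_left)
  have "w \<circ> h \<in> weight_simplex ?K"
    using w hI reindex[of w] by (simp add: weight_simplex_def)
  then have "gate \<in> gaussian_gates X ?K"
    unfolding gaussian_gates_def gate_def using \<open>0 < t\<close>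
    by (intro CollectI exI[of _ "w \<circ> h"] exI[of _ "\<nu> \<circ> h"] exI[of _ "\<lambda>_. ?S"])
      (simp add: sym_pos_def_mat)
  moreover have "location_scale \<psi> (\<mu> i) (\<sigma> i) \<in> location_scale_class \<psi> \<inter> L_infinity Y"
    if "i \<in> I" for i
    using \<sigma>[OF that] assms(1,2)
    by (auto simp: location_scale_class_def
        intro!: continuous_on_compact_L_infinity continuous_location_scale_snd)
  moreover have "m (x, y) = (\<Sum>k=1..?K. gate k x * location_scale \<psi> (\<mu> (h k)) (\<sigma> (h k)) y)"
    if "x \<in> X" "y \<in> Y" for x y
    unfolding m[OF that] gate_eq by (subst reindex[symmetric]) simp
  ultimately show ?thesis
    unfolding gaussian_gated_moe_def using \<open>1 \<le> ?K\<close> \<mu> \<sigma> hI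
    by (intro CollectI exI[of _ ?K] exI[of _ gate] exI[of _ "\<mu> \<circ> h"] exI[of _ "\<sigma> \<circ> h"]) simp
qed

text \<open>Each pair of a net point and a mixture centre becomes one component of weight
  \<open>w \<nu> \<mu> / card N\<close>. Components over the same net point share their Gaussian,
  and their gates add up to \<open>softmax t N \<nu>\<close> because the weights
  \<open>w \<nu>\<close> have sum one.\<close>

lemma softmax_mixture_gaussian_gated_moe:
  fixes \<psi> :: "real^'q \<Rightarrow> real" and N :: "(real^'d) set"
  assumes "compact Y" "continuous_on UNIV \<psi>" "finite N" "N \<noteq> {}" "0 < t"
    and M: "\<And>\<nu>. \<nu> \<in> N \<Longrightarrow> finite (M \<nu>)" "\<And>\<nu>. \<nu> \<in> N \<Longrightarrow> M \<nu> \<subseteq> Y"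
    and w: "\<And>\<nu> \<mu>. \<nu> \<in> N \<Longrightarrow> \<mu> \<in> M \<nu> \<Longrightarrow> 0 \<le> w \<nu> \<mu>"
      "\<And>\<nu>. \<nu> \<in> N \<Longrightarrow> (\<Sum>\<mu>\<in>M \<nu>. w \<nu> \<mu>) = 1"
    and \<sigma>: "\<And>\<nu>. \<nu> \<in> N \<Longrightarrow> 0 < \<sigma> \<nu>"
  shows "(\<lambda>(x, y). \<Sum>\<nu>\<in>N. softmax t N \<nu> x * (\<Sum>\<mu>\<in>M \<nu>. w \<nu> \<mu> * location_scale \<psi> \<mu> (\<sigma> \<nu>) y))
    \<in> gaussian_gated_moe X Y \<psi>"
proof -
  \<comment> \<open>Pairs of weight zero are discarded, since \<open>weight_simplex\<close> demands
    strictly positive weights; their terms vanish in every sum.\<close>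
  define I where "I = (SIGMA \<nu>:N. {\<mu> \<in> M \<nu>. 0 < w \<nu> \<mu>})"
  define W where "W = (\<lambda>(\<nu>, \<mu>). w \<nu> \<mu> / card N)"
  let ?e = "\<lambda>x \<nu>. exp (- (t * (norm (x - \<nu>))\<^sup>2))"
  have "0 < card N"
    using assms by (simp add: card_gt_0_iff)
  have sum_I: "(\<Sum>(\<nu>, \<mu>)\<in>I. w \<nu> \<mu> * F \<nu> \<mu>) = (\<Sum>\<nu>\<in>N. \<Sum>\<mu>\<in>M \<nu>. w \<nu> \<mu> * F \<nu> \<mu>)"
    for F :: "real^'d \<Rightarrow> real^'q \<Rightarrow> real"
  proof -
    have "(\<Sum>(\<nu>, \<mu>)\<in>I. w \<nu> \<mu> * F \<nu> \<mu>) = (\<Sum>\<nu>\<in>N. \<Sum>\<mu>\<in>{\<mu> \<in> M \<nu>. 0 < w \<nu> \<mu>}. w \<nu> \<mu> * F \<nu> \<mu>)"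
      unfolding I_def using \<open>finite N\<close> M(1) by (intro sum.Sigma[symmetric]) auto
    also have "\<dots> = (\<Sum>\<nu>\<in>N. \<Sum>\<mu>\<in>M \<nu>. w \<nu> \<mu> * F \<nu> \<mu>)"
      using M(1) w(1) by (intro sum.cong refl sum.mono_neutral_left) (auto simp: order.order_iff_strict)
    finally show ?thesis .
  qed
  show ?thesis
  proof (rule gaussian_gated_moe_finite_index[where I=I and t=t and w=W and \<nu>=fst and \<mu>=snd
        and \<sigma>="\<sigma> \<circ> fst"])
    show "finite I"
      unfolding I_def using \<open>finite N\<close> M(1) by auto
    show "0 < W i" "snd i \<in> Y" "0 < (\<sigma> \<circ> fst) i" if "i \<in> I" for i
      using that subsetD[OF M(2)] \<sigma> \<open>0 < card N\<close> by (auto simp: I_def W_def)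
    show "sum W I = 1"
      using sum_I[of "\<lambda>_ _. 1 / card N"] w(2) \<open>0 < card N\<close>
      by (simp add: W_def flip: sum_divide_distrib)
    fix x y
    \<comment> \<open>Summing over the mixture centres first leaves the softmax denominator divided
      by \<open>card N\<close>; the same factor stands in each \<open>W i\<close> and
      cancels.\<close>
    have denom: "(\<Sum>j\<in>I. W j * ?e x (fst j)) = (\<Sum>n\<in>N. ?e x n) / card N"
      using sum_I[of "\<lambda>\<nu> _. ?e x \<nu> / card N"] w(2)
      by (simp add: W_def case_prod_unfold flip: sum_divide_distrib sum_distrib_right)
    have "(\<Sum>\<nu>\<in>N. softmax t N \<nu> x * (\<Sum>\<mu>\<in>M \<nu>. w \<nu> \<mu> * location_scale \<psi> \<mu> (\<sigma> \<nu>) y))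
        = (\<Sum>(\<nu>, \<mu>)\<in>I. w \<nu> \<mu> * (softmax t N \<nu> x * location_scale \<psi> \<mu> (\<sigma> \<nu>) y))"
      unfolding sum_I by (simp add: sum_distrib_left mult.left_commute)
    also have "\<dots> = (\<Sum>i\<in>I. W i * ?e x (fst i) / ((\<Sum>n\<in>N. ?e x n) / card N)
        * location_scale \<psi> (snd i) ((\<sigma> \<circ> fst) i) y)"
      using \<open>0 < card N\<close> by (simp add: W_def case_prod_unfold softmax_def mult.assoc)
    finally show "(case (x, y) of (x, y) \<Rightarrow>
          \<Sum>\<nu>\<in>N. softmax t N \<nu> x * (\<Sum>\<mu>\<in>M \<nu>. w \<nu> \<mu> * location_scale \<psi> \<mu> (\<sigma> \<nu>) y))
        = (\<Sum>i\<in>I. W i * ?e x (fst i) / (\<Sum>j\<in>I. W j * ?e x (fst j))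
            * location_scale \<psi> (snd i) ((\<sigma> \<circ> fst) i) y)"
      unfolding denom by simp
  qed (use assms in auto)
qed

subsection \<open>Mollification on a compact set\<close>

lemma emeasure_lborel_compact:
  "compact Y \<Longrightarrow> emeasure lborel Y = ennreal (measure lborel Y)"
  by (metis emeasure_compact_finite emeasure_eq_ennreal_measure infinity_ennreal_def less_irrefl)

lemma integrable_bounded_mult:
  fixes f g :: "'a \<Rightarrow> real"
  assumes "integrable M g" "f \<in> borel_measurable M" "\<And>x. \<bar>f x\<bar> \<le> B"
  shows "integrable M (\<lambda>x. f x * g x)"
proof (rule Bochner_Integration.integrable_bound[OF integrable_mult_right[OF assms(1), of B]])
  have "norm (f x * g x) \<le> norm (B * g x)" for x
    unfolding norm_mult using assms(3)[of x] by (intro mult_right_mono) auto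
  then show "AE x in M. norm (f x * g x) \<le> norm (B * g x)"
    by (rule AE_I2)
qed (use assms in auto)

text \<open>Outer regularity encloses \<open>Y\<close> in an open \<open>T\<close> with
  \<open>T - Y\<close> of measure below \<open>\<epsilon>\<close>, and compactness leaves a margin
  \<open>r\<close> around \<open>Y\<close> inside \<open>T\<close>.\<close>

lemma compact_translation_overlap:
  fixes Y :: "'a::euclidean_space set"
  assumes "compact Y" "0 < \<epsilon>"
  obtains r where "0 < r" "\<And>v. norm v < r \<Longrightarrow> emeasure lborel {y \<in> Y. y - v \<notin> Y} \<le> ennreal \<epsilon>"
proof -
  have Y: "Y \<in> lmeasurable" and closed: "closed Y"
    using assms by (auto simp: lmeasurable_compact compact_imp_closed)
  obtain T where T: "open T" "Y \<subseteq> T" "T - Y \<in> sets lebesgue" "emeasure lebesgue (T - Y) < ennreal \<epsilon>"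
    using sets_lebesgue_outer_open[of Y \<epsilon>] Y \<open>0 < \<epsilon>\<close>
    by (metis fmeasurableD)
  obtain r where r: "0 < r" "(\<Union>y\<in>Y. ball y r) \<subseteq> T"
    using compact_subset_open_imp_ball_epsilon_subset[OF assms(1) T(1,2)] by blast
  show thesis
  proof (rule that[OF r(1)])
    fix v :: 'a assume v: "norm v < r"
    let ?E = "{y \<in> Y. y - v \<notin> Y}"
    have "?E = Y \<inter> (\<lambda>y. y - v) -` (- Y)"
      by auto
    moreover have "open ((\<lambda>y. y - v) -` (- Y))"
      using closed by (intro continuous_open_vimage continuous_intros) auto
    ultimately have E: "?E \<in> sets borel"
      using closed by simp
    have "emeasure lborel ?E = emeasure lebesgue ?E"
      using E by simp
    \<comment> \<open>Translation by \<open>- v\<close> preserves the measure and moves the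
      exceptional set out of \<open>Y\<close>, yet by less than the margin, hence into
      \<open>T - Y\<close>.\<close>
    also have "\<dots> = emeasure lebesgue ((\<lambda>y. 1 *\<^sub>R y + - v) ` ?E)"
      using emeasure_lebesgue_affine[of 1 "- v" ?E] by simp
    also have "\<dots> \<le> emeasure lebesgue (T - Y)"
    proof (intro emeasure_mono)
      show "(\<lambda>y. 1 *\<^sub>R y + - v) ` ?E \<subseteq> T - Y"
        using r(2) v by (force simp: dist_norm)
      show "T - Y \<in> sets lebesgue"
        by (rule T(3))
    qed
    finally show "emeasure lborel ?E \<le> ennreal \<epsilon>"
      using T(4) by order
  qed
qed

text \<open>Where \<open>y\<close> and \<open>y - v\<close> both lie in \<open>Y\<close>, uniform
  continuity of \<open>g\<close> bounds the difference; the other points of \<open>Y\<close> form a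
  set of small measure, on which the difference is at most \<open>\<bar>B\<bar>\<close>.\<close>

lemma translation_continuity_L1:
  fixes g :: "'a::euclidean_space \<Rightarrow> real"
  assumes "compact Y" "continuous_on Y g" "\<And>y. y \<in> Y \<Longrightarrow> 0 \<le> g y" "\<And>y. y \<in> Y \<Longrightarrow> g y \<le> B" "0 < \<epsilon>"
  defines "G \<equiv> \<lambda>y. indicator Y y * g y"
  obtains r where "0 < r"
    "\<And>v. norm v < r \<Longrightarrow> (\<integral>\<^sup>+y. ennreal \<bar>G y - G (y - v)\<bar> * indicator Y y \<partial>lborel) \<le> ennreal \<epsilon>"
proof -
  let ?L = "measure lborel Y"
  \<comment> \<open>Chosen to absorb \<open>?L\<close> from the uniform error and
    \<open>\<bar>B\<bar>\<close> from the exceptional set; the summand 1 keeps the divisor positive.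
    The absolute value covers an empty \<open>Y\<close>, where \<open>B\<close> may be
    negative.\<close>
  define \<eta> where "\<eta> = \<epsilon> / (?L + \<bar>B\<bar> + 1)"
  have "0 < ?L + \<bar>B\<bar> + 1"
    by (simp add: add_nonneg_pos)
  then have "\<eta> * (?L + \<bar>B\<bar> + 1) = \<epsilon>" "0 < \<eta>"
    using \<open>0 < \<epsilon>\<close> by (auto simp: \<eta>_def)
  then have \<eta>: "0 < \<eta>" "\<eta> * ?L + \<bar>B\<bar> * \<eta> \<le> \<epsilon>"
    by (auto simp: algebra_simps)
  have Y: "Y \<in> sets borel" "emeasure lborel Y = ennreal ?L"
    using assms(1) by (simp_all add: compact_imp_closed emeasure_lborel_compact)
  obtain r1 where r1: "0 < r1"
    "\<And>v. norm v < r1 \<Longrightarrow> emeasure lborel {y \<in> Y. y - v \<notin> Y} \<le> ennreal \<eta>"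
    using compact_translation_overlap[OF assms(1) \<eta>(1)] by blast
  have "uniformly_continuous_on Y g"
    using assms(1,2) compact_uniformly_continuous by blast
  then obtain r2 where r2: "0 < r2" "\<And>y z. y \<in> Y \<Longrightarrow> z \<in> Y \<Longrightarrow> dist z y < r2 \<Longrightarrow> dist (g z) (g y) < \<eta>"
    using \<eta>(1) unfolding uniformly_continuous_on_def by blast
  show thesis
  proof (rule that[of "min r1 r2"])
    show "0 < min r1 r2"
      using r1(1) r2(1) by simp
    fix v :: 'a assume v: "norm v < min r1 r2"
    let ?E = "{y \<in> Y. y - v \<notin> Y}"
    have [measurable]: "Y \<in> sets borel"
      by (rule Y(1))
    have E: "?E \<in> sets borel"
      by measurable
    have "ennreal \<bar>G y - G (y - v)\<bar> * indicator Y y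
        \<le> ennreal \<eta> * indicator Y y + ennreal \<bar>B\<bar> * indicator ?E y" for y
    proof (cases "y \<in> Y")
      case True
      have "\<bar>G y - G (y - v)\<bar> \<le> \<eta>" if "y - v \<in> Y"
        using r2(2)[OF True that] v True that by (simp add: G_def dist_norm)
      moreover have "\<bar>G y - G (y - v)\<bar> \<le> \<bar>B\<bar>" if "y - v \<notin> Y"
        using assms(3,4)[OF True] True that by (simp add: G_def)
      ultimately show ?thesis
        using True by (cases "y - v \<in> Y") (auto intro: ennreal_leI add_increasing)
    qed simp
    then have "(\<integral>\<^sup>+y. ennreal \<bar>G y - G (y - v)\<bar> * indicator Y y \<partial>lborel)
        \<le> (\<integral>\<^sup>+y. ennreal \<eta> * indicator Y y + ennreal \<bar>B\<bar> * indicator ?E y \<partial>lborel)"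
      by (intro nn_integral_mono)
    also have "\<dots> = ennreal \<eta> * emeasure lborel Y + ennreal \<bar>B\<bar> * emeasure lborel ?E"
      using Y(1) E by (simp add: nn_integral_add nn_integral_cmult)
    also have "\<dots> \<le> ennreal \<eta> * ennreal ?L + ennreal \<bar>B\<bar> * ennreal \<eta>"
      using r1(2)[of v] v Y(2) by (intro add_mono mult_left_mono) auto
    also have "\<dots> \<le> ennreal \<epsilon>"
      using \<eta> by (simp add: ennreal_leI flip: ennreal_mult ennreal_plus)
    finally show "(\<integral>\<^sup>+y. ennreal \<bar>G y - G (y - v)\<bar> * indicator Y y \<partial>lborel) \<le> ennreal \<epsilon>" .
  qed
qed

text \<open>The truncations of \<open>\<psi>\<close> to the complements of growing balls tend to
  zero pointwise and are dominated by \<open>\<psi>\<close>, so their integrals tend to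
  zero.\<close>

lemma integrable_tail:
  fixes \<psi> :: "'a::euclidean_space \<Rightarrow> real"
  assumes "integrable lborel \<psi>" "\<And>u. 0 \<le> \<psi> u" "0 < \<epsilon>"
  obtains R where "0 < R" "(\<integral>\<^sup>+u. ennreal (\<psi> u) * indicator {u. R \<le> norm u} u \<partial>lborel) \<le> ennreal \<epsilon>"
proof -
  let ?h = "\<lambda>n u. indicator {u. real n \<le> norm u} u * \<psi> u"
  have [measurable]: "\<psi> \<in> borel_measurable borel"
    using assms(1) by auto
  have "(\<lambda>n. integral\<^sup>L lborel (?h n)) \<longlonglongrightarrow> integral\<^sup>L lborel (\<lambda>_::'a. 0 :: real)"
  proof (rule integral_dominated_convergence[where w=\<psi>])
    show "AE u in lborel. (\<lambda>n. ?h n u) \<longlonglongrightarrow> 0"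
    proof (intro AE_I2 tendsto_eventually)
      fix u :: 'a
      obtain m :: nat where "norm u < real m"
        using reals_Archimedean2 by blast
      then show "\<forall>\<^sub>F n in sequentially. ?h n u = 0"
        by (intro eventually_sequentiallyI[of m]) (auto simp: indicator_def)
    qed
  qed (use assms in \<open>auto simp: indicator_def\<close>)
  then have "\<forall>\<^sub>F n in sequentially. integral\<^sup>L lborel (?h n) < \<epsilon>"
    using \<open>0 < \<epsilon>\<close> by (intro order_tendstoD(2)[of _ 0]) auto
  \<comment> \<open>A positive radius is requested because it serves as a divisor in the choice of
    the scale later.\<close>
  then obtain n :: nat where n: "0 < n" "integral\<^sup>L lborel (?h n) < \<epsilon>"
    using eventually_happens[OF eventually_conj[OF _ eventually_gt_at_top[of 0]]] by auto
  have "integrable lborel (?h n)"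
    using integrable_mult_indicator[of "{u. real n \<le> norm u}" lborel \<psi>] assms(1) by simp
  then have "(\<integral>\<^sup>+u. ennreal (?h n u) \<partial>lborel) = ennreal (integral\<^sup>L lborel (?h n))"
    using assms(2) by (intro nn_integral_eq_integral) auto
  also have "\<dots> \<le> ennreal \<epsilon>"
    using n(2) by (intro ennreal_leI) simp
  also have "(\<lambda>u. ennreal (?h n u)) = (\<lambda>u. ennreal (\<psi> u) * indicator {u. n \<le> norm u} u)"
    by (auto simp: indicator_def)
  finally show thesis
    using n(1) by (intro that[of "real n"]) auto
qed

text \<open>The mollification averages the translates of \<open>G\<close> by
  \<open>\<sigma> *\<^sub>R u\<close> against \<open>\<psi> u\<close>. By Fubini its error is at
  most the average of the translation errors \<open>D (\<sigma> *\<^sub>R u)\<close>, which are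
  small for bounded \<open>u\<close>, while large \<open>u\<close> carry little mass.\<close>

lemma mollification_L1:
  fixes g \<psi> :: "'a::euclidean_space \<Rightarrow> real"
  assumes "compact Y" "continuous_on Y g" "\<And>y. y \<in> Y \<Longrightarrow> 0 \<le> g y" "\<And>y. y \<in> Y \<Longrightarrow> g y \<le> B" "0 < \<epsilon>"
    and \<psi>: "integrable lborel \<psi>" "\<And>u. 0 \<le> \<psi> u" "(LINT u|lborel. \<psi> u) = 1"
  defines "G \<equiv> \<lambda>y. indicator Y y * g y"
  obtains \<sigma> where "0 < \<sigma>"
    "(\<integral>\<^sup>+y. ennreal \<bar>G y - (LINT u|lborel. G (y - \<sigma> *\<^sub>R u) * \<psi> u)\<bar> * indicator Y y \<partial>lborel) \<le> ennreal \<epsilon>"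
proof -
  let ?L = "measure lborel Y"
  \<comment> \<open>The 1 accounts for the bulk of \<open>\<psi>\<close>, with translation error
    \<open>\<eta>\<close> and mass at most one; \<open>\<bar>B\<bar> * ?L\<close> accounts for its
    tail, with the crude error bound and mass at most \<open>\<eta>\<close>.\<close>
  define \<eta> where "\<eta> = \<epsilon> / (1 + \<bar>B\<bar> * ?L)"
  have "0 < 1 + \<bar>B\<bar> * ?L"
    by (simp add: add_pos_nonneg)
  then have "\<eta> * (1 + \<bar>B\<bar> * ?L) = \<epsilon>" "0 < \<eta>"
    using \<open>0 < \<epsilon>\<close> by (auto simp: \<eta>_def)
  then have \<eta>: "0 < \<eta>" "\<eta> + \<bar>B\<bar> * ?L * \<eta> \<le> \<epsilon>"
    by (auto simp: algebra_simps)
  have Y: "Y \<in> sets borel" "emeasure lborel Y = ennreal ?L"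
    using assms(1) by (simp_all add: compact_imp_closed emeasure_lborel_compact)
  have [measurable]: "\<psi> \<in> borel_measurable borel" "Y \<in> sets borel"
    using \<psi>(1) Y(1) by auto
  have [measurable]: "G \<in> borel_measurable borel"
    unfolding G_def using borel_measurable_continuous_on_indicator[OF Y(1) assms(2)] by simp
  have G: "0 \<le> G y" "G y \<le> \<bar>B\<bar>" for y
    using assms(3,4)[of y] by (auto simp: G_def indicator_def)
  define D where "D v = (\<integral>\<^sup>+y. ennreal \<bar>G y - G (y - v)\<bar> * indicator Y y \<partial>lborel)" for v
  obtain r where r: "0 < r" "\<And>v. norm v < r \<Longrightarrow> D v \<le> ennreal \<eta>"
    using translation_continuity_L1[OF assms(1-4) \<eta>(1)] unfolding D_def G_def by blast
  obtain R where R: "0 < R" "(\<integral>\<^sup>+u. ennreal (\<psi> u) * indicator {u. R \<le> norm u} u \<partial>lborel) \<le> ennreal \<eta>"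
    using integrable_tail[OF \<psi>(1,2) \<eta>(1)] by blast
  have D_le: "D v \<le> ennreal (\<bar>B\<bar> * ?L)" for v
  proof -
    have "D v \<le> (\<integral>\<^sup>+y. ennreal \<bar>B\<bar> * indicator Y y \<partial>lborel)"
      unfolding D_def
    proof (intro nn_integral_mono mult_right_mono ennreal_leI)
      show "\<bar>G y - G (y - v)\<bar> \<le> \<bar>B\<bar>" for y
        using G[of y] G[of "y - v"] by linarith
    qed simp
    then show ?thesis
      using Y by (simp add: nn_integral_cmult ennreal_mult)
  qed
  \<comment> \<open>With this scale, \<open>norm u < R\<close> forces the shift
    \<open>\<sigma> *\<^sub>R u\<close> to be shorter than \<open>r\<close>.\<close>
  define \<sigma> where "\<sigma> = r / R"
  have "0 < \<sigma>"
    using r(1) R(1) by (simp add: \<sigma>_def)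
  have int: "integrable lborel (\<lambda>u. G (y - \<sigma> *\<^sub>R u) * \<psi> u)" for y
    using G by (intro integrable_bounded_mult[where B="\<bar>B\<bar>"] \<psi>(1)) auto
  have "ennreal \<bar>G y - (LINT u|lborel. G (y - \<sigma> *\<^sub>R u) * \<psi> u)\<bar>
      \<le> (\<integral>\<^sup>+u. ennreal (\<bar>G y - G (y - \<sigma> *\<^sub>R u)\<bar> * \<psi> u) \<partial>lborel)" for y
  proof -
    \<comment> \<open>As \<open>\<psi>\<close> has mass one, \<open>G y\<close> is itself an
      integral against \<open>\<psi>\<close>, so the difference passes under the integral.\<close>
    have "G y - (LINT u|lborel. G (y - \<sigma> *\<^sub>R u) * \<psi> u)
        = (LINT u|lborel. G y * \<psi> u - G (y - \<sigma> *\<^sub>R u) * \<psi> u)"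
      using \<psi> int by simp
    also have "ennreal \<bar>\<dots>\<bar> \<le> (\<integral>\<^sup>+u. norm (G y * \<psi> u - G (y - \<sigma> *\<^sub>R u) * \<psi> u) \<partial>lborel)"
      using integral_norm_bound_ennreal[of lborel "\<lambda>u. G y * \<psi> u - G (y - \<sigma> *\<^sub>R u) * \<psi> u"] \<psi>(1) int
      by simp
    finally show ?thesis
      using \<psi>(2) by (simp add: abs_mult flip: left_diff_distrib)
  qed
  then have "(\<integral>\<^sup>+y. ennreal \<bar>G y - (LINT u|lborel. G (y - \<sigma> *\<^sub>R u) * \<psi> u)\<bar> * indicator Y y \<partial>lborel)
      \<le> (\<integral>\<^sup>+y. (\<integral>\<^sup>+u. ennreal (\<bar>G y - G (y - \<sigma> *\<^sub>R u)\<bar> * \<psi> u) \<partial>lborel) * indicator Y y \<partial>lborel)"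
    by (intro nn_integral_mono mult_right_mono) auto
  also have "\<dots> = (\<integral>\<^sup>+y. (\<integral>\<^sup>+u. ennreal (\<psi> u) * (ennreal \<bar>G y - G (y - \<sigma> *\<^sub>R u)\<bar> * indicator Y y) \<partial>lborel) \<partial>lborel)"
    using \<psi>(2)
    by (intro nn_integral_cong, subst nn_integral_multc[symmetric]) (auto simp: ennreal_mult mult_ac)
  also have "\<dots> = (\<integral>\<^sup>+u. (\<integral>\<^sup>+y. ennreal (\<psi> u) * (ennreal \<bar>G y - G (y - \<sigma> *\<^sub>R u)\<bar> * indicator Y y) \<partial>lborel) \<partial>lborel)"
    by (intro lborel_pair.Fubini') measurable
  also have "\<dots> = (\<integral>\<^sup>+u. ennreal (\<psi> u) * D (\<sigma> *\<^sub>R u) \<partial>lborel)"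
    unfolding D_def by (intro nn_integral_cong nn_integral_cmult) measurable
  also have "\<dots> \<le> (\<integral>\<^sup>+u. ennreal \<eta> * ennreal (\<psi> u)
      + ennreal (\<bar>B\<bar> * ?L) * (ennreal (\<psi> u) * indicator {u. R \<le> norm u} u) \<partial>lborel)"
  proof (intro nn_integral_mono)
    fix u :: 'a
    have "D (\<sigma> *\<^sub>R u) \<le> ennreal \<eta> + ennreal (\<bar>B\<bar> * ?L) * indicator {u. R \<le> norm u} u"
    proof (cases "R \<le> norm u")
      case True
      then show ?thesis
        using D_le by (simp add: add_increasing)
    next
      case False
      then have "norm (\<sigma> *\<^sub>R u) < r"
        using r(1) R(1) by (simp add: \<sigma>_def field_simps)
      then show ?thesis
        using r(2) by (simp add: False)
    qed
    then have "ennreal (\<psi> u) * D (\<sigma> *\<^sub>R u)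
        \<le> ennreal (\<psi> u) * (ennreal \<eta> + ennreal (\<bar>B\<bar> * ?L) * indicator {u. R \<le> norm u} u)"
      by (intro mult_left_mono) auto
    then show "ennreal (\<psi> u) * D (\<sigma> *\<^sub>R u) \<le> ennreal \<eta> * ennreal (\<psi> u)
        + ennreal (\<bar>B\<bar> * ?L) * (ennreal (\<psi> u) * indicator {u. R \<le> norm u} u)"
      by (simp add: distrib_left mult_ac)
  qed
  also have "\<dots> = ennreal \<eta> * (\<integral>\<^sup>+u. ennreal (\<psi> u) \<partial>lborel)
      + ennreal (\<bar>B\<bar> * ?L) * (\<integral>\<^sup>+u. ennreal (\<psi> u) * indicator {u. R \<le> norm u} u \<partial>lborel)"
    by (simp add: nn_integral_add nn_integral_cmult)
  also have "(\<integral>\<^sup>+u. ennreal (\<psi> u) \<partial>lborel) = 1"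
    using nn_integral_eq_integral[OF \<psi>(1)] \<psi>(2,3) by simp
  also have "ennreal \<eta> * 1 + ennreal (\<bar>B\<bar> * ?L) * (\<integral>\<^sup>+u. ennreal (\<psi> u) * indicator {u. R \<le> norm u} u \<partial>lborel)
      \<le> ennreal \<eta> * 1 + ennreal (\<bar>B\<bar> * ?L) * ennreal \<eta>"
    using R(2) by (intro add_left_mono mult_left_mono) auto
  also have "\<dots> \<le> ennreal \<epsilon>"
    using \<eta> by (simp add: ennreal_leI flip: ennreal_mult ennreal_plus)
  finally show thesis
    using \<open>0 < \<sigma>\<close> that by blast
qed

subsection \<open>Location-scale mixtures\<close>

text \<open>Substitute \<open>\<mu> = y - \<sigma> *\<^sub>R u\<close>: the Jacobian
  \<open>\<sigma> ^ CARD('q)\<close> cancels the normalisation of the expert. A convolution thus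
  becomes a continuous mixture of experts with centres distributed according to
  \<open>G\<close>.\<close>

lemma location_scale_convolution:
  fixes G \<psi> :: "real^'q \<Rightarrow> real"
  assumes [measurable]: "G \<in> borel_measurable borel" "\<psi> \<in> borel_measurable borel" and "0 < \<sigma>"
  shows "(LINT \<mu>|lborel. G \<mu> * location_scale \<psi> \<mu> \<sigma> y) = (LINT u|lborel. G (y - \<sigma> *\<^sub>R u) * \<psi> u)"
proof -
  have [measurable]: "(\<lambda>\<mu>. location_scale \<psi> \<mu> \<sigma> y) \<in> borel_measurable borel"
    unfolding location_scale_def by measurable
  have "(LINT \<mu>|lborel. G \<mu> * location_scale \<psi> \<mu> \<sigma> y)
      = (LINT \<mu>|density (distr lborel borel (\<lambda>u. y + (- \<sigma>) *\<^sub>R u)) (\<lambda>_. ennreal (\<sigma> ^ CARD('q))).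
          G \<mu> * location_scale \<psi> \<mu> \<sigma> y)"
    using lborel_affine[of "- \<sigma>" y] \<open>0 < \<sigma>\<close> by (simp add: ennreal_power)
  also have "\<dots> = (LINT u|lborel. \<sigma> ^ CARD('q) *
      (G (y - \<sigma> *\<^sub>R u) * location_scale \<psi> (y - \<sigma> *\<^sub>R u) \<sigma> y))"
    using \<open>0 < \<sigma>\<close> by (simp add: integral_density integral_distr)
  also have "\<dots> = (LINT u|lborel. G (y - \<sigma> *\<^sub>R u) * \<psi> u)"
    using \<open>0 < \<sigma>\<close> by (simp add: location_scale_def field_simps)
  finally show ?thesis .
qed

section \<open>Discretisation of a continuous mixture\<close>

lemma finite_borel_partition_of_balls:
  fixes M :: "'a::metric_space set"
  assumes "finite M"
  obtains A where "\<And>\<mu>. \<mu> \<in> M \<Longrightarrow> A \<mu> \<in> sets borel" "\<And>\<mu>. \<mu> \<in> M \<Longrightarrow> A \<mu> \<subseteq> ball \<mu> r"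
    "disjoint_family_on A M" "(\<Union>\<mu>\<in>M. A \<mu>) = (\<Union>\<mu>\<in>M. ball \<mu> r)"
proof -
  have "\<exists>A. (\<forall>\<mu>\<in>M. A \<mu> \<in> sets borel \<and> A \<mu> \<subseteq> ball \<mu> r) \<and> disjoint_family_on A M \<and>
      (\<Union>\<mu>\<in>M. A \<mu>) = (\<Union>\<mu>\<in>M. ball \<mu> r)"
    using assms
  proof (induction M rule: finite_induct)
    case empty
    show ?case
      by (simp add: disjoint_family_on_def)
  next
    case (insert m M)
    from insert.IH obtain A where A: "\<forall>\<mu>\<in>M. A \<mu> \<in> sets borel \<and> A \<mu> \<subseteq> ball \<mu> r"
      "disjoint_family_on A M" "(\<Union>\<mu>\<in>M. A \<mu>) = (\<Union>\<mu>\<in>M. ball \<mu> r)"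
      by (elim exE conjE)
    \<comment> \<open>The new centre receives the part of its ball that the earlier balls leave
      uncovered.\<close>
    define A' where "A' = A(m := ball m r - (\<Union>\<mu>\<in>M. ball \<mu> r))"
    have A'_eq: "A' \<mu> = A \<mu>" if "\<mu> \<in> M" for \<mu>
      using that insert.hyps(2) by (auto simp: A'_def)
    have A'_m: "A' m = ball m r - (\<Union>\<mu>\<in>M. A \<mu>)"
      by (simp add: A'_def A(3))
    have "\<forall>\<mu>\<in>insert m M. A' \<mu> \<in> sets borel \<and> A' \<mu> \<subseteq> ball \<mu> r"
    proof (intro ballI conjI)
      have "open (\<Union>\<mu>\<in>M. ball \<mu> r)"
        by blast
      then show "A' \<mu> \<in> sets borel" "A' \<mu> \<subseteq> ball \<mu> r" if "\<mu> \<in> insert m M" for \<mu>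
        using that A(1) by (auto simp: A'_def)
    qed
    moreover have "disjoint_family_on A' (insert m M)"
      using A(2) insert.hyps(2) by (auto simp: A'_m A'_eq disjoint_family_on_def)
    moreover have "(\<Union>\<mu>\<in>insert m M. A' \<mu>) = (\<Union>\<mu>\<in>insert m M. ball \<mu> r)"
      using A(3) by (auto simp: A'_m A'_eq)
    ultimately show ?case
      by (intro exI[of _ A'] conjI)
  qed
  then obtain A where "\<forall>\<mu>\<in>M. A \<mu> \<in> sets borel \<and> A \<mu> \<subseteq> ball \<mu> r" "disjoint_family_on A M"
    "(\<Union>\<mu>\<in>M. A \<mu>) = (\<Union>\<mu>\<in>M. ball \<mu> r)"
    by (elim exE conjE)
  then show thesis
    by (intro that[of A]) auto
qed

text \<open>This is a Riemann sum uniform in the parameter \<open>y\<close>: on the compact product,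
  \<open>k (_, y)\<close> varies by less than \<open>\<epsilon>\<close> on the part of each cell
  inside \<open>Y\<close>, with one radius for all \<open>y\<close> in \<open>C\<close>. Since
  \<open>g\<close> has mass one on \<open>Y\<close>, the total error is at most
  \<open>\<epsilon>\<close>.\<close>

lemma integral_mixture_approximation:
  fixes g :: "'a::euclidean_space \<Rightarrow> real" and k :: "'a \<times> 'b::metric_space \<Rightarrow> real"
  assumes "compact Y" "continuous_on Y g" "\<And>y. y \<in> Y \<Longrightarrow> 0 \<le> g y"
    and g1: "(LINT y|lborel. indicator Y y * g y) = 1"
    and "compact C" "continuous_on (Y \<times> C) k" "0 < \<epsilon>"
  obtains M w where "finite M" "M \<subseteq> Y" "\<And>\<mu>. \<mu> \<in> M \<Longrightarrow> 0 \<le> w \<mu>" "(\<Sum>\<mu>\<in>M. w \<mu>) = 1"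
    "\<And>y. y \<in> C \<Longrightarrow> \<bar>(\<Sum>\<mu>\<in>M. w \<mu> * k (\<mu>, y)) - (LINT z|lborel. indicator Y z * g z * k (z, y))\<bar> \<le> \<epsilon>"
proof -
  let ?G = "\<lambda>z. indicator Y z * g z"
  have "uniformly_continuous_on (Y \<times> C) k"
    using assms by (intro compact_uniformly_continuous compact_Times)
  then obtain r where r: "0 < r"
      "\<And>z z'. z \<in> Y \<times> C \<Longrightarrow> z' \<in> Y \<times> C \<Longrightarrow> dist z' z < r \<Longrightarrow> dist (k z') (k z) < \<epsilon>"
    using \<open>0 < \<epsilon>\<close> unfolding uniformly_continuous_on_def by blast
  obtain M where M: "M \<subseteq> Y" "finite M" "Y \<subseteq> (\<Union>\<mu>\<in>M. ball \<mu> r)"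
    using compactE_image[OF \<open>compact Y\<close>, of Y "\<lambda>\<mu>. ball \<mu> r"] r(1) by force
  obtain A where A: "\<And>\<mu>. \<mu> \<in> M \<Longrightarrow> A \<mu> \<in> sets borel" "\<And>\<mu>. \<mu> \<in> M \<Longrightarrow> A \<mu> \<subseteq> ball \<mu> r"
    "disjoint_family_on A M" "(\<Union>\<mu>\<in>M. A \<mu>) = (\<Union>\<mu>\<in>M. ball \<mu> r)"
    using finite_borel_partition_of_balls[OF M(2)] by blast
  have G: "0 \<le> ?G z" for z
    using assms(3) by (simp add: indicator_def)
  have int_G: "integrable lborel ?G"
    using borel_integrable_compact[OF assms(1,2)] by simp
  \<comment> \<open>The cells are disjoint and cover \<open>Y\<close>, outside of which
    \<open>?G\<close> vanishes.\<close>
  have sum_A: "(\<Sum>\<mu>\<in>M. indicator (A \<mu>) z * ?G z) = ?G z" for z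
  proof -
    have "(\<Sum>\<mu>\<in>M. indicator (A \<mu>) z) = (indicator (\<Union>\<mu>\<in>M. ball \<mu> r) z :: real)"
      by (simp add: indicator_UN_disjoint[OF M(2) A(3)] flip: A(4))
    then show ?thesis
      using M(3) by (auto simp: indicator_def simp flip: sum_distrib_right)
  qed
  have sum_A_mult: "(\<Sum>\<mu>\<in>M. indicator (A \<mu>) z * ?G z * c) = ?G z * c" for z c
    unfolding sum_distrib_right[of _ M c, symmetric] sum_A ..
  have int_A: "integrable lborel (\<lambda>z. indicator (A \<mu>) z * ?G z)" if "\<mu> \<in> M" for \<mu>
    using integrable_mult_indicator[OF _ int_G, of "A \<mu>"] A(1)[OF that] by simp
  \<comment> \<open>The weight of a centre is the mass of its cell under the density
    \<open>?G\<close>, so the weights are nonnegative and add up to one.\<close>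
  define w where "w \<mu> = (LINT z|lborel. indicator (A \<mu>) z * ?G z)" for \<mu>
  show thesis
  proof (rule that[OF M(2,1), of w])
    show "0 \<le> w \<mu>" for \<mu>
      unfolding w_def using G by (intro integral_nonneg_AE AE_I2) simp
    show "(\<Sum>\<mu>\<in>M. w \<mu>) = 1"
      unfolding w_def using int_A g1 sum_A by (subst Bochner_Integration.integral_sum[symmetric]) auto
    fix y assume y: "y \<in> C"
    have "continuous_on Y (\<lambda>z. g z * k (z, y))"
      using y by (intro continuous_intros assms(2) continuous_on_compose2[OF assms(6)]) auto
    from borel_integrable_compact[OF assms(1) this]
    have int_k: "integrable lborel (\<lambda>z. ?G z * k (z, y))"
      by (simp add: mult.assoc)
    have int: "integrable lborel (\<lambda>z. indicator (A \<mu>) z * ?G z * k (\<mu>, y))" if "\<mu> \<in> M" for \<mu>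
      using int_A[OF that] by (intro integrable_mult_left) auto
    have summand: "\<bar>indicator (A \<mu>) z * ?G z * k (\<mu>, y) - indicator (A \<mu>) z * ?G z * k (z, y)\<bar>
        \<le> indicator (A \<mu>) z * ?G z * \<epsilon>" if "\<mu> \<in> M" for \<mu> z
    proof (cases "z \<in> A \<mu> \<and> z \<in> Y")
      case True
      have "dist (k (\<mu>, y)) (k (z, y)) < \<epsilon>"
        using True that A(2)[OF that] M(1) y by (intro r(2)) (auto simp: dist_Pair_Pair)
      then have "\<bar>g z * (k (\<mu>, y) - k (z, y))\<bar> \<le> g z * \<epsilon>"
        unfolding abs_mult using True assms(3) by (intro mult_mono) (auto simp: dist_real_def)
      then show ?thesis
        using True by (simp add: right_diff_distrib)
    qed auto
    have bound: "\<bar>(\<Sum>\<mu>\<in>M. indicator (A \<mu>) z * ?G z * k (\<mu>, y)) - ?G z * k (z, y)\<bar> \<le> \<epsilon> * ?G z" for z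
    proof -
      have "(\<Sum>\<mu>\<in>M. indicator (A \<mu>) z * ?G z * k (\<mu>, y)) - ?G z * k (z, y)
          = (\<Sum>\<mu>\<in>M. indicator (A \<mu>) z * ?G z * k (\<mu>, y) - indicator (A \<mu>) z * ?G z * k (z, y))"
        by (simp only: sum_subtractf sum_A_mult)
      also have "\<bar>\<dots>\<bar> \<le> (\<Sum>\<mu>\<in>M. indicator (A \<mu>) z * ?G z * \<epsilon>)"
        by (intro order_trans[OF sum_abs] sum_mono summand)
      finally show ?thesis
        unfolding sum_A_mult by (simp only: mult.commute)
    qed
    have "(\<Sum>\<mu>\<in>M. w \<mu> * k (\<mu>, y)) - (LINT z|lborel. ?G z * k (z, y))
        = (LINT z|lborel. (\<Sum>\<mu>\<in>M. indicator (A \<mu>) z * ?G z * k (\<mu>, y)) - ?G z * k (z, y))"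
      unfolding w_def using int int_k by (simp add: Bochner_Integration.integral_sum)
    also have "\<bar>\<dots>\<bar> \<le> (LINT z|lborel. \<bar>(\<Sum>\<mu>\<in>M. indicator (A \<mu>) z * ?G z * k (\<mu>, y)) - ?G z * k (z, y)\<bar>)"
      by (rule integral_abs_bound)
    also have "\<dots> \<le> (LINT z|lborel. \<epsilon> * ?G z)"
      using int int_k int_G by (intro integral_mono bound) (auto intro!: Bochner_Integration.integrable_sum)
    also have "\<dots> = \<epsilon>"
      using g1 by simp
    finally show "\<bar>(\<Sum>\<mu>\<in>M. w \<mu> * k (\<mu>, y)) - (LINT z|lborel. ?G z * k (z, y))\<bar> \<le> \<epsilon>" .
  qed
qed

text \<open>Mollification costs half of \<open>\<epsilon>\<close> in the integral, discretising the
  convolution the other half. The pointwise bound holds because \<open>g\<close> and its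
  mollification both take values between 0 and \<open>\<bar>B\<bar>\<close> on \<open>Y\<close>;
  near the boundary of \<open>Y\<close> they need not be close.\<close>

lemma location_scale_mixture_approximation:
  fixes g \<psi> :: "real^'q \<Rightarrow> real"
  assumes "compact Y" "continuous_on Y g" "\<And>y. y \<in> Y \<Longrightarrow> 0 \<le> g y" "\<And>y. y \<in> Y \<Longrightarrow> g y \<le> B"
    and g1: "(LINT y|lborel. indicator Y y * g y) = 1"
    and \<psi>: "continuous_on UNIV \<psi>" "integrable lborel \<psi>" "\<And>u. 0 \<le> \<psi> u" "(LINT u|lborel. \<psi> u) = 1"
    and "0 < \<epsilon>"
  obtains M w \<sigma> where "finite M" "M \<subseteq> Y" "\<And>\<mu>. \<mu> \<in> M \<Longrightarrow> 0 \<le> w \<mu>" "(\<Sum>\<mu>\<in>M. w \<mu>) = 1" "0 < \<sigma>"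
    "\<And>y. y \<in> Y \<Longrightarrow> \<bar>g y - (\<Sum>\<mu>\<in>M. w \<mu> * location_scale \<psi> \<mu> \<sigma> y)\<bar> \<le> \<bar>B\<bar> + \<epsilon>"
    "(\<integral>\<^sup>+y. ennreal \<bar>g y - (\<Sum>\<mu>\<in>M. w \<mu> * location_scale \<psi> \<mu> \<sigma> y)\<bar> * indicator Y y \<partial>lborel) \<le> ennreal \<epsilon>"
proof -
  let ?G = "\<lambda>z. indicator Y z * g z" and ?L = "measure lborel Y"
  \<comment> \<open>A uniform error \<open>\<eta>\<close> integrates over \<open>Y\<close> to at
    most \<open>\<epsilon> / 2\<close>; the summand 1 also ensures
    \<open>\<eta> \<le> \<epsilon>\<close>, which the pointwise bound uses.\<close>
  define \<eta> where "\<eta> = \<epsilon> / 2 / (?L + 1)"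
  have "0 < ?L + 1"
    by (simp add: add_nonneg_pos)
  then have "\<eta> * (?L + 1) = \<epsilon> / 2" "0 < \<eta>"
    using \<open>0 < \<epsilon>\<close> by (simp_all add: \<eta>_def del: divide_divide_eq_left)
  moreover from this have "0 \<le> \<eta> * ?L"
    by simp
  ultimately have \<eta>: "0 < \<eta>" "\<eta> * ?L \<le> \<epsilon> / 2" "\<eta> \<le> \<epsilon>"
    unfolding distrib_left by linarith+
  have Y: "Y \<in> sets borel" "emeasure lborel Y = ennreal ?L"
    using assms(1) by (simp_all add: compact_imp_closed emeasure_lborel_compact)
  have [measurable]: "?G \<in> borel_measurable borel" "\<psi> \<in> borel_measurable borel"
    using borel_measurable_continuous_on_indicator[OF Y(1) assms(2)] \<psi>(2) by auto
  have "0 < \<epsilon> / 2"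
    using \<open>0 < \<epsilon>\<close> by simp
  then obtain \<sigma> where \<sigma>: "0 < \<sigma>"
    "(\<integral>\<^sup>+y. ennreal \<bar>?G y - (LINT u|lborel. ?G (y - \<sigma> *\<^sub>R u) * \<psi> u)\<bar> * indicator Y y \<partial>lborel) \<le> ennreal (\<epsilon> / 2)"
    using mollification_L1[OF assms(1-4) _ \<psi>(2-4)] by blast
  define h where "h y = (LINT u|lborel. ?G (y - \<sigma> *\<^sub>R u) * \<psi> u)" for y
  obtain M w where M: "finite M" "M \<subseteq> Y" "\<And>\<mu>. \<mu> \<in> M \<Longrightarrow> 0 \<le> w \<mu>" "(\<Sum>\<mu>\<in>M. w \<mu>) = 1"
    "\<And>y. y \<in> Y \<Longrightarrow> \<bar>(\<Sum>\<mu>\<in>M. w \<mu> * location_scale \<psi> (fst (\<mu>, y)) \<sigma> (snd (\<mu>, y))) -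
      (LINT z|lborel. ?G z * location_scale \<psi> (fst (z, y)) \<sigma> (snd (z, y)))\<bar> \<le> \<eta>"
    using integral_mixture_approximation[OF assms(1-3) g1 assms(1) continuous_location_scale[OF \<psi>(1)] \<eta>(1)]
    by blast
  let ?p = "\<lambda>y. \<Sum>\<mu>\<in>M. w \<mu> * location_scale \<psi> \<mu> \<sigma> y"
  have p: "\<bar>?p y - h y\<bar> \<le> \<eta>" if "y \<in> Y" for y
    using M(5)[OF that] \<sigma>(1) by (simp add: h_def location_scale_convolution)
  have G: "0 \<le> ?G y" "?G y \<le> \<bar>B\<bar>" for y
    using assms(3,4)[of y] by (auto simp: indicator_def)
  have "integrable lborel (\<lambda>u. ?G (y - \<sigma> *\<^sub>R u) * \<psi> u)" for y
    using G by (intro integrable_bounded_mult[where B="\<bar>B\<bar>"] \<psi>(2)) auto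
  \<comment> \<open>An average with respect to a probability density cannot exceed the bound of the
    averaged function.\<close>
  then have "h y \<le> (LINT u|lborel. \<bar>B\<bar> * \<psi> u)" for y
    unfolding h_def using G \<psi>(2,3) by (intro integral_mono mult_right_mono) auto
  then have h: "0 \<le> h y" "h y \<le> \<bar>B\<bar>" for y
    using G \<psi>(3,4) by (auto simp: h_def intro!: integral_nonneg_AE mult_nonneg_nonneg)
  show thesis
  proof (rule that[OF M(1-4) \<sigma>(1)])
    show "\<bar>g y - ?p y\<bar> \<le> \<bar>B\<bar> + \<epsilon>" if "y \<in> Y" for y
      using p[OF that] h[of y] assms(3,4)[OF that] \<eta>(3) by linarith
    have [measurable]: "h \<in> borel_measurable borel"
      unfolding h_def by measurable
    have "(\<integral>\<^sup>+y. ennreal \<bar>g y - ?p y\<bar> * indicator Y y \<partial>lborel)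
        \<le> (\<integral>\<^sup>+y. ennreal \<bar>?G y - h y\<bar> * indicator Y y + ennreal \<eta> * indicator Y y \<partial>lborel)"
    proof (intro nn_integral_mono)
      fix y
      have "\<bar>g y - ?p y\<bar> \<le> \<bar>g y - h y\<bar> + \<eta>" if "y \<in> Y"
        using p[OF that] by linarith
      then show "ennreal \<bar>g y - ?p y\<bar> * indicator Y y
          \<le> ennreal \<bar>?G y - h y\<bar> * indicator Y y + ennreal \<eta> * indicator Y y"
        using \<eta>(1) by (cases "y \<in> Y") (simp_all add: ennreal_leI flip: ennreal_plus)
    qed
    also have "\<dots> = (\<integral>\<^sup>+y. ennreal \<bar>?G y - h y\<bar> * indicator Y y \<partial>lborel) + ennreal \<eta> * emeasure lborel Y"
      using Y(1) by (simp add: nn_integral_add nn_integral_cmult)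
    also have "\<dots> \<le> ennreal (\<epsilon> / 2) + ennreal (\<epsilon> / 2)"
      using \<sigma>(2) \<eta>(1,2) by (intro add_mono) (auto simp: h_def Y(2) simp flip: ennreal_mult intro: ennreal_leI)
    finally show "(\<integral>\<^sup>+y. ennreal \<bar>g y - ?p y\<bar> * indicator Y y \<partial>lborel) \<le> ennreal \<epsilon>"
      using \<open>0 < \<epsilon>\<close> by (simp flip: ennreal_plus)
  qed
qed

subsection \<open>Approximation and convergence\<close>

text \<open>The definitions integrate over \<open>lebesgue_on\<close>, whereas Fubini and
  substitution are applied to \<open>lborel\<close>. The function cut off by the indicator is Borel,
  so passing to the completion does not change its integral.\<close>

lemma lebesgue_on_compact_continuous:
  fixes h :: "'a::euclidean_space \<Rightarrow> real"
  assumes "compact S" "continuous_on S h"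
  shows "integrable (lebesgue_on S) h"
    and "(LINT z|lebesgue_on S. h z) = (LINT z|lborel. indicator S z * h z)"
proof -
  have S: "S \<in> sets borel" "S \<in> sets lebesgue"
    using assms(1) by (auto simp: compact_imp_closed)
  have "(\<lambda>z. indicator S z *\<^sub>R h z) \<in> borel_measurable lborel"
    using borel_measurable_continuous_on_indicator[OF S(1) assms(2)] by simp
  then show "integrable (lebesgue_on S) h"
      "(LINT z|lebesgue_on S. h z) = (LINT z|lborel. indicator S z * h z)"
    using borel_integrable_compact[OF assms] S(2)
    by (simp_all add: integrable_restrict_space integral_restrict_space integrable_completion
        integral_completion)
qed

lemma nn_integral_compact_continuous:
  fixes h :: "'a::euclidean_space \<Rightarrow> real"
  assumes "compact S" "continuous_on S h"
  shows "(\<integral>\<^sup>+z. ennreal \<bar>h z\<bar> * indicator S z \<partial>lborel) = ennreal (LINT z|lebesgue_on S. \<bar>h z\<bar>)"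
    and "(\<lambda>z. ennreal \<bar>h z\<bar> * indicator S z) \<in> borel_measurable borel"
proof -
  have "continuous_on S (\<lambda>z. \<bar>h z\<bar>)"
    using assms(2) by (intro continuous_intros)
  note int = borel_integrable_compact[OF assms(1) this]
  have eq: "(\<lambda>z. ennreal \<bar>h z\<bar> * indicator S z) = (\<lambda>z. ennreal (indicator S z *\<^sub>R \<bar>h z\<bar>))"
    by (auto simp: indicator_def)
  show "(\<lambda>z. ennreal \<bar>h z\<bar> * indicator S z) \<in> borel_measurable borel"
    unfolding eq using int by simp
  have "(\<integral>\<^sup>+z. ennreal (indicator S z *\<^sub>R \<bar>h z\<bar>) \<partial>lborel) = ennreal (LINT z|lborel. indicator S z *\<^sub>R \<bar>h z\<bar>)"
    by (intro nn_integral_eq_integral int) simp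
  then show "(\<integral>\<^sup>+z. ennreal \<bar>h z\<bar> * indicator S z \<partial>lborel) = ennreal (LINT z|lebesgue_on S. \<bar>h z\<bar>)"
    unfolding eq using lebesgue_on_compact_continuous(2)[OF assms(1) \<open>continuous_on S (\<lambda>z. \<bar>h z\<bar>)\<close>] by simp
qed

text \<open>In the softmax average each slice \<open>f (\<nu>, _)\<close> is replaced by a mixture.
  The softmax weights are convex, so the pointwise bound and the integral error of the slices carry
  over to the average at every \<open>x\<close>; integrating over \<open>X\<close> yields the last
  estimate.\<close>

lemma gaussian_gated_moe_approximation:
  fixes f :: "(real^'d) \<times> (real^'q) \<Rightarrow> real"
  assumes X: "compact X" "X \<noteq> {}" and Y: "compact Y"
    and f: "f \<in> conditional_pdfs X Y" "continuous_on (X \<times> Y) f" "\<And>z. z \<in> X \<times> Y \<Longrightarrow> f z \<le> B"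
    and \<psi>: "pdf \<psi>" "continuous_on UNIV \<psi>"
    and "0 < \<epsilon>"
  obtains m where "m \<in> gaussian_gated_moe X Y \<psi>" "continuous_on (X \<times> Y) m"
    "\<And>z. z \<in> X \<times> Y \<Longrightarrow> \<bar>f z - m z\<bar> \<le> \<bar>B\<bar> + \<epsilon>"
    "(LINT z|lebesgue_on (X \<times> Y). \<bar>f z - m z\<bar>) \<le> \<epsilon>"
proof -
  let ?LX = "measure lborel X" and ?LY = "measure lborel Y"
  \<comment> \<open>Softmax and slices each contribute one \<open>\<eta>\<close>. The 2 serves the
    pointwise bound, the product the integral over \<open>X \<times> Y\<close>, where the softmax
    error is uniform and the slice error is already integrated over \<open>Y\<close>.\<close>
  define \<eta> where "\<eta> = \<epsilon> / (2 + ?LX * (?LY + 1))"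
  have "0 < 2 + ?LX * (?LY + 1)"
    by (intro add_pos_nonneg mult_nonneg_nonneg) auto
  then have "\<eta> * (2 + ?LX * (?LY + 1)) = \<epsilon>" "0 < \<eta>"
    using \<open>0 < \<epsilon>\<close> by (auto simp: \<eta>_def)
  moreover from this have "0 \<le> ?LX * (\<eta> * ?LY + \<eta>)"
    by simp
  ultimately have \<eta>: "0 < \<eta>" "?LX * (\<eta> * ?LY + \<eta>) \<le> \<epsilon>" "2 * \<eta> \<le> \<epsilon>"
    by (auto simp: algebra_simps)
  have [measurable]: "\<psi> \<in> borel_measurable borel"
    using \<psi>(2) by (rule borel_measurable_continuous_onI)
  have \<psi>_int: "(LINT u|lborel. \<psi> u) = 1"
    using \<psi>(1) by (simp add: pdf_def integral_completion)
  \<comment> \<open>Integrability follows from the value 1, because a non-integrable function would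
    have integral 0.\<close>
  then have \<psi>': "continuous_on UNIV \<psi>" "integrable lborel \<psi>" "\<And>u. 0 \<le> \<psi> u" "(LINT u|lborel. \<psi> u) = 1"
    using \<psi> not_integrable_integral_eq[of lborel \<psi>] by (auto simp: pdf_def)
  have slice: "continuous_on Y (\<lambda>y. f (x, y))" if "x \<in> X" for x
    using that by (intro continuous_on_compose2[OF f(2)] continuous_intros) auto
  have f_nonneg: "\<And>z. z \<in> X \<times> Y \<Longrightarrow> 0 \<le> f z"
    using f(1) by (auto simp: conditional_pdfs_def)
  obtain N t where N: "finite N" "N \<noteq> {}" "N \<subseteq> X" "0 < t"
    "\<And>x y. x \<in> X \<Longrightarrow> y \<in> Y \<Longrightarrow> \<bar>(\<Sum>\<nu>\<in>N. softmax t N \<nu> x * f (\<nu>, y)) - f (x, y)\<bar> \<le> \<eta>"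
    using softmax_approximation[OF X Y f(2) \<eta>(1)] by blast
  define mix where "mix M w \<sigma> y = (\<Sum>\<mu>\<in>M. w \<mu> * location_scale \<psi> \<mu> \<sigma> y)" for M w \<sigma> y
  \<comment> \<open>Centres, weights and scale are packed into one triple so that a single use of
    choice picks them for all net points; outside \<open>N\<close> the condition is vacuous.\<close>
  have "\<forall>\<nu>. \<exists>F. case F of (M, w, \<sigma>) \<Rightarrow> \<nu> \<in> N \<longrightarrow>
      finite M \<and> M \<subseteq> Y \<and> (\<forall>\<mu>\<in>M. 0 \<le> w \<mu>) \<and> (\<Sum>\<mu>\<in>M. w \<mu>) = 1 \<and> 0 < \<sigma> \<and>
      (\<forall>y\<in>Y. \<bar>f (\<nu>, y) - mix M w \<sigma> y\<bar> \<le> \<bar>B\<bar> + \<eta>) \<and>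
      (\<integral>\<^sup>+y. ennreal \<bar>f (\<nu>, y) - mix M w \<sigma> y\<bar> * indicator Y y \<partial>lborel) \<le> ennreal \<eta>"
    (is "\<forall>\<nu>. \<exists>F. case F of (M, w, \<sigma>) \<Rightarrow> ?P \<nu> M w \<sigma>")
  proof
    fix \<nu>
    show "\<exists>F. case F of (M, w, \<sigma>) \<Rightarrow> ?P \<nu> M w \<sigma>"
    proof (cases "\<nu> \<in> N")
      case True
      then have \<nu>: "\<nu> \<in> X"
        using N(3) by blast
      then have "(LINT y|lborel. indicator Y y * f (\<nu>, y)) = 1"
        using f(1) lebesgue_on_compact_continuous(2)[OF Y slice[OF \<nu>]] by (simp add: conditional_pdfs_def)
      note g1 = this
      show ?thesis
      proof (rule location_scale_mixture_approximation[OF Y slice[OF \<nu>] _ _ g1 \<psi>' \<eta>(1)])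
        show "0 \<le> f (\<nu>, y)" "f (\<nu>, y) \<le> B" if "y \<in> Y" for y
          using \<nu> that by (auto intro: f_nonneg f(3))
        fix M w \<sigma>
        assume "finite M" "M \<subseteq> Y" "\<And>\<mu>. \<mu> \<in> M \<Longrightarrow> 0 \<le> w \<mu>" "sum w M = 1" "0 < \<sigma>"
          "\<And>y. y \<in> Y \<Longrightarrow> \<bar>f (\<nu>, y) - (\<Sum>\<mu>\<in>M. w \<mu> * location_scale \<psi> \<mu> \<sigma> y)\<bar> \<le> \<bar>B\<bar> + \<eta>"
          "(\<integral>\<^sup>+y. ennreal \<bar>f (\<nu>, y) - (\<Sum>\<mu>\<in>M. w \<mu> * location_scale \<psi> \<mu> \<sigma> y)\<bar> * indicator Y y \<partial>lborel)
            \<le> ennreal \<eta>"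
        then have "?P \<nu> M w \<sigma>"
          by (simp add: mix_def)
        then show ?thesis
          by (intro exI[of _ "(M, w, \<sigma>)"]) simp
      qed
    qed simp
  qed
  from choice[OF this] obtain F where F: "\<forall>\<nu>. case F \<nu> of (M, w, \<sigma>) \<Rightarrow> ?P \<nu> M w \<sigma>"
    by (elim exE)
  define M w \<sigma> where "M \<nu> = fst (F \<nu>)" and "w \<nu> = fst (snd (F \<nu>))" and "\<sigma> \<nu> = snd (snd (F \<nu>))" for \<nu>
  have M: "?P \<nu> (M \<nu>) (w \<nu>) (\<sigma> \<nu>)" for \<nu>
    using spec[OF F, of \<nu>] by (simp add: M_def w_def \<sigma>_def case_prod_unfold)
  define p where "p \<nu> y = (\<Sum>\<mu>\<in>M \<nu>. w \<nu> \<mu> * location_scale \<psi> \<mu> (\<sigma> \<nu>) y)" for \<nu> y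
  have p_bound: "\<bar>f (\<nu>, y) - p \<nu> y\<bar> \<le> \<bar>B\<bar> + \<eta>" if "\<nu> \<in> N" "y \<in> Y" for \<nu> y
    using M[of \<nu>] that by (simp add: p_def mix_def)
  have p_L1: "(\<integral>\<^sup>+y. ennreal \<bar>f (\<nu>, y) - p \<nu> y\<bar> * indicator Y y \<partial>lborel) \<le> ennreal \<eta>" if "\<nu> \<in> N" for \<nu>
    using M[of \<nu>] that by (simp add: p_def mix_def)
  have p_cont: "continuous_on A (p \<nu>)" for A \<nu>
    unfolding p_def by (intro continuous_intros continuous_location_scale_snd \<psi>(2))
  define m where "m = (\<lambda>(x, y). \<Sum>\<nu>\<in>N. softmax t N \<nu> x * p \<nu> y)"
  have m_cont: "continuous_on (X \<times> Y) m"
    unfolding m_def case_prod_unfold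
    by (intro continuous_intros continuous_on_compose2[OF continuous_on_softmax[OF N(1,2), of UNIV]]
        continuous_on_compose2[OF p_cont[of UNIV]]) auto
  have sum_s: "(\<Sum>\<nu>\<in>N. softmax t N \<nu> x) = 1" for x
    by (rule sum_softmax[OF N(1,2)])
  \<comment> \<open>The first term is the error of the softmax average of the exact slices, the
    second the averaged error of their mixtures.\<close>
  have diff: "\<bar>f (x, y) - m (x, y)\<bar> \<le> \<eta> + (\<Sum>\<nu>\<in>N. softmax t N \<nu> x * \<bar>f (\<nu>, y) - p \<nu> y\<bar>)"
    if "x \<in> X" "y \<in> Y" for x y
  proof -
    have "\<bar>(\<Sum>\<nu>\<in>N. softmax t N \<nu> x * f (\<nu>, y)) - m (x, y)\<bar>
        = \<bar>\<Sum>\<nu>\<in>N. softmax t N \<nu> x * (f (\<nu>, y) - p \<nu> y)\<bar>"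
      by (simp add: m_def right_diff_distrib sum_subtractf)
    also have "\<dots> \<le> (\<Sum>\<nu>\<in>N. softmax t N \<nu> x * \<bar>f (\<nu>, y) - p \<nu> y\<bar>)"
      by (rule order_trans[OF sum_abs]) (simp add: abs_mult softmax_nonneg)
    finally show ?thesis
      using N(5)[OF that] by linarith
  qed
  have m_bound: "\<bar>f z - m z\<bar> \<le> \<bar>B\<bar> + \<epsilon>" if "z \<in> X \<times> Y" for z
  proof -
    obtain x y where z: "z = (x, y)" "x \<in> X" "y \<in> Y"
      using \<open>z \<in> X \<times> Y\<close> by blast
    have "(\<Sum>\<nu>\<in>N. softmax t N \<nu> x * \<bar>f (\<nu>, y) - p \<nu> y\<bar>) \<le> (\<Sum>\<nu>\<in>N. softmax t N \<nu> x * (\<bar>B\<bar> + \<eta>))"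
      using z p_bound by (intro sum_mono mult_left_mono softmax_nonneg) auto
    also have "\<dots> = \<bar>B\<bar> + \<eta>"
      using sum_s by (simp flip: sum_distrib_right)
    finally show ?thesis
      using diff[OF z(2,3)] \<eta>(3) z(1) by simp
  qed
  have slice_L1: "(\<integral>\<^sup>+y. ennreal \<bar>f (x, y) - m (x, y)\<bar> * indicator Y y \<partial>lborel) \<le> ennreal (\<eta> * ?LY + \<eta>)"
    if x: "x \<in> X" for x
  proof -
    have meas [measurable]: "(\<lambda>y. ennreal \<bar>f (\<nu>, y) - p \<nu> y\<bar> * indicator Y y) \<in> borel_measurable borel" if "\<nu> \<in> N" for \<nu>
      using that N(3) by (intro nn_integral_compact_continuous(2) Y continuous_intros slice p_cont) auto
    have "(\<integral>\<^sup>+y. ennreal \<bar>f (x, y) - m (x, y)\<bar> * indicator Y y \<partial>lborel)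
        \<le> (\<integral>\<^sup>+y. ennreal \<eta> * indicator Y y
             + (\<Sum>\<nu>\<in>N. ennreal (softmax t N \<nu> x) * (ennreal \<bar>f (\<nu>, y) - p \<nu> y\<bar> * indicator Y y)) \<partial>lborel)"
    proof (intro nn_integral_mono)
      fix y
      show "ennreal \<bar>f (x, y) - m (x, y)\<bar> * indicator Y y \<le> ennreal \<eta> * indicator Y y
          + (\<Sum>\<nu>\<in>N. ennreal (softmax t N \<nu> x) * (ennreal \<bar>f (\<nu>, y) - p \<nu> y\<bar> * indicator Y y))"
        using ennreal_leI[OF diff[OF x, of y]] \<eta>(1)
        by (cases "y \<in> Y") (simp_all add: ennreal_plus sum_nonneg softmax_nonneg flip: ennreal_mult sum_ennreal)
    qed
    also have "\<dots> = ennreal \<eta> * emeasure lborel Y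
        + (\<Sum>\<nu>\<in>N. ennreal (softmax t N \<nu> x) * (\<integral>\<^sup>+y. ennreal \<bar>f (\<nu>, y) - p \<nu> y\<bar> * indicator Y y \<partial>lborel))"
    proof -
      have "Y \<in> sets borel"
        using Y by (simp add: compact_imp_closed)
      then have "(\<integral>\<^sup>+y. ennreal \<eta> * indicator Y y
             + (\<Sum>\<nu>\<in>N. ennreal (softmax t N \<nu> x) * (ennreal \<bar>f (\<nu>, y) - p \<nu> y\<bar> * indicator Y y)) \<partial>lborel)
        = (\<integral>\<^sup>+y. ennreal \<eta> * indicator Y y \<partial>lborel)
             + (\<integral>\<^sup>+y. (\<Sum>\<nu>\<in>N. ennreal (softmax t N \<nu> x) * (ennreal \<bar>f (\<nu>, y) - p \<nu> y\<bar> * indicator Y y)) \<partial>lborel)"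
        by (intro nn_integral_add) (auto intro!: borel_measurable_sum borel_measurable_times_ennreal meas)
      also have "(\<integral>\<^sup>+y. (\<Sum>\<nu>\<in>N. ennreal (softmax t N \<nu> x) * (ennreal \<bar>f (\<nu>, y) - p \<nu> y\<bar> * indicator Y y)) \<partial>lborel)
          = (\<Sum>\<nu>\<in>N. \<integral>\<^sup>+y. ennreal (softmax t N \<nu> x) * (ennreal \<bar>f (\<nu>, y) - p \<nu> y\<bar> * indicator Y y) \<partial>lborel)"
        by (intro nn_integral_sum) (auto intro!: borel_measurable_times_ennreal meas)
      also have "\<dots> = (\<Sum>\<nu>\<in>N. ennreal (softmax t N \<nu> x) * (\<integral>\<^sup>+y. ennreal \<bar>f (\<nu>, y) - p \<nu> y\<bar> * indicator Y y \<partial>lborel))"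
        by (intro sum.cong refl nn_integral_cmult) (auto intro: meas)
      finally show ?thesis
        using \<open>Y \<in> sets borel\<close> by (simp add: nn_integral_cmult)
    qed
    also have "\<dots> \<le> ennreal \<eta> * ennreal ?LY + (\<Sum>\<nu>\<in>N. ennreal (softmax t N \<nu> x) * ennreal \<eta>)"
      unfolding emeasure_lborel_compact[OF Y] using p_L1 by (intro add_left_mono sum_mono mult_left_mono) auto
    also have "(\<Sum>\<nu>\<in>N. ennreal (softmax t N \<nu> x) * ennreal \<eta>) = ennreal \<eta>"
      using sum_s[of x] by (simp add: sum_ennreal softmax_nonneg flip: sum_distrib_right)
    finally show ?thesis
      using \<eta>(1) by (simp flip: ennreal_mult ennreal_plus)
  qed
  have Z: "compact (X \<times> Y)"
    using X Y by (intro compact_Times)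
  have cont: "continuous_on (X \<times> Y) (\<lambda>z. f z - m z)"
    by (intro continuous_intros f(2) m_cont)
  \<comment> \<open>Nonnegative integrals over \<open>lborel\<close> allow the slice estimate to be
    integrated over \<open>X\<close> by Tonelli.\<close>
  have "ennreal (LINT z|lebesgue_on (X \<times> Y). \<bar>f z - m z\<bar>)
      = (\<integral>\<^sup>+z. ennreal \<bar>f z - m z\<bar> * indicator (X \<times> Y) z \<partial>(lborel \<Otimes>\<^sub>M lborel))"
    using nn_integral_compact_continuous(1)[OF Z cont] by (simp add: lborel_prod)
  also have "\<dots> = (\<integral>\<^sup>+x. \<integral>\<^sup>+y. ennreal \<bar>f (x, y) - m (x, y)\<bar> * indicator (X \<times> Y) (x, y) \<partial>lborel \<partial>lborel)"
    using nn_integral_compact_continuous(2)[OF Z cont] by (intro lborel.nn_integral_fst[symmetric]) (simp add: lborel_prod)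
  also have "\<dots> \<le> (\<integral>\<^sup>+x. ennreal (\<eta> * ?LY + \<eta>) * indicator X x \<partial>lborel)"
  proof (intro nn_integral_mono)
    fix x
    show "(\<integral>\<^sup>+y. ennreal \<bar>f (x, y) - m (x, y)\<bar> * indicator (X \<times> Y) (x, y) \<partial>lborel)
        \<le> ennreal (\<eta> * ?LY + \<eta>) * indicator X x"
      using slice_L1[of x] by (cases "x \<in> X") (simp_all add: indicator_times)
  qed
  also have "\<dots> = ennreal (?LX * (\<eta> * ?LY + \<eta>))"
  proof -
    have "X \<in> sets lborel" "0 \<le> \<eta> * ?LY + \<eta>"
      using X(1) \<eta>(1) by (simp_all add: compact_imp_closed)
    then show ?thesis
      by (simp only: nn_integral_cmult_indicator emeasure_lborel_compact[OF X(1)]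
          ennreal_mult[symmetric] measure_nonneg mult.commute[of ?LX])
  qed
  also have "\<dots> \<le> ennreal \<epsilon>"
    by (rule ennreal_leI[OF \<eta>(2)])
  finally have "(LINT z|lebesgue_on (X \<times> Y). \<bar>f z - m z\<bar>) \<le> \<epsilon>"
    using \<open>0 < \<epsilon>\<close> by (subst (asm) ennreal_le_iff) auto
  moreover have "m \<in> gaussian_gated_moe X Y \<psi>"
    unfolding m_def p_def using M[unfolded mix_def]
    by (intro softmax_mixture_gaussian_gated_moe Y \<psi>(2) N(1,2,4)) auto
  ultimately show thesis
    using m_cont m_bound that by blast
qed

section \<open>From L1 convergence to Lp and almost uniform convergence\<close>

lemma Lp_norm_bounded_tendsto_0:
  fixes h :: "nat \<Rightarrow> 'a::euclidean_space \<Rightarrow> real"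
  assumes "compact Z" "1 \<le> p" "\<And>K. continuous_on Z (h K)" "\<And>K z. z \<in> Z \<Longrightarrow> \<bar>h K z\<bar> \<le> C"
    and "(\<lambda>K. LINT z|lebesgue_on Z. \<bar>h K z\<bar>) \<longlonglongrightarrow> 0"
  shows "(\<lambda>K. Lp_norm p Z (h K)) \<longlonglongrightarrow> 0"
proof -
  let ?I = "\<lambda>K. LINT z|lebesgue_on Z. \<bar>h K z\<bar>" and ?J = "\<lambda>K. LINT z|lebesgue_on Z. \<bar>h K z\<bar> powr p"
  have "continuous_on Z (\<lambda>z. \<bar>h K z\<bar> powr p)" for K
    using assms(2) by (intro continuous_on_powr' continuous_intros assms(3)) auto
  \<comment> \<open>This selects the finite branch of \<open>Lp_norm\<close>.\<close>
  then have int_p: "integrable (lebesgue_on Z) (\<lambda>z. \<bar>h K z\<bar> powr p)" for K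
    by (rule lebesgue_on_compact_continuous(1)[OF assms(1)])
  have int: "integrable (lebesgue_on Z) (\<lambda>z. \<bar>h K z\<bar>)" for K
    by (intro lebesgue_on_compact_continuous(1)[OF assms(1)] continuous_intros assms(3))
  have "?J K \<le> \<bar>C\<bar> powr (p - 1) * ?I K" for K
  proof -
    \<comment> \<open>Uniform boundedness trades \<open>p - 1\<close> of the powers for a constant,
      so that L1 convergence controls every exponent \<open>p\<close>.\<close>
    have "\<bar>h K z\<bar> powr p \<le> \<bar>C\<bar> powr (p - 1) * \<bar>h K z\<bar>" if "z \<in> space (lebesgue_on Z)" for z
    proof -
      have "\<bar>h K z\<bar> powr p = \<bar>h K z\<bar> powr (p - 1) * \<bar>h K z\<bar>"
        using powr_add[of "\<bar>h K z\<bar>" "p - 1" 1] by simp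
      also have "\<dots> \<le> \<bar>C\<bar> powr (p - 1) * \<bar>h K z\<bar>"
      proof (intro mult_right_mono powr_mono2)
        show "\<bar>h K z\<bar> \<le> \<bar>C\<bar>"
          using assms(4)[of z K] that by simp
      qed (use assms(2) in auto)
      finally show ?thesis .
    qed
    then have "?J K \<le> (LINT z|lebesgue_on Z. \<bar>C\<bar> powr (p - 1) * \<bar>h K z\<bar>)"
      using int int_p by (intro integral_mono) auto
    then show ?thesis
      by simp
  qed
  moreover have "0 \<le> ?J K" for K
    by (intro integral_nonneg_AE) simp
  moreover have "(\<lambda>K. \<bar>C\<bar> powr (p - 1) * ?I K) \<longlonglongrightarrow> 0"
    using assms(5) by (rule tendsto_mult_right_zero)
  ultimately have "?J \<longlonglongrightarrow> 0"
    by (intro tendsto_sandwich[of "\<lambda>_. 0" ?J sequentially "\<lambda>K. \<bar>C\<bar> powr (p - 1) * ?I K" 0]) auto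
  then have "(\<lambda>K. ?J K powr (1 / p)) \<longlonglongrightarrow> 0"
    using assms(2) \<open>\<And>K. 0 \<le> ?J K\<close> by (intro tendsto_zero_powrI[of _ _ _ "1 / p"]) auto
  then have "(\<lambda>K. ennreal (?J K powr (1 / p))) \<longlonglongrightarrow> ennreal 0"
    by (rule tendsto_ennrealI)
  then show ?thesis
    by (simp add: Lp_norm_def int_p)
qed

text \<open>Borel--Cantelli: the sets where the error exceeds \<open>2 ^ (- K)\<close> have summable measures.\<close>

lemma almost_uniform_limit_of_fast_L1:
  fixes h :: "nat \<Rightarrow> 'a::euclidean_space \<Rightarrow> real"
  assumes "compact Z" "\<And>K. continuous_on Z (\<lambda>z. f z - m K z)"
    and L1: "\<And>K. (LINT z|lebesgue_on Z. \<bar>f z - m K z\<bar>) \<le> (1 / 4) ^ K"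
  shows "almost_uniform_limit Z m f"
  unfolding almost_uniform_limit_def
proof (intro allI impI)
  fix \<delta> :: real assume "0 < \<delta>"
  \<comment> \<open>The comparison of the error with \<open>2 ^ (- K)\<close> is written in the form
    of Markov's inequality.\<close>
  define A where "A K = {z \<in> Z. 1 \<le> ennreal (2 ^ K) * ennreal \<bar>f z - m K z\<bar>}" for K
  note [measurable] = nn_integral_compact_continuous(2)[OF assms(1,2)]
  have A: "A K \<in> sets lborel" for K
  proof -
    have "A K = {z \<in> space lborel. 1 \<le> ennreal (2 ^ K) * (ennreal \<bar>f z - m K z\<bar> * indicator Z z)}"
      by (auto simp: A_def indicator_def split: if_splits)
    then show ?thesis
      by simp
  qed
  \<comment> \<open>Markov's inequality costs a factor \<open>2 ^ K\<close> against the rate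
    \<open>(1 / 4) ^ K\<close>; the summable \<open>(1 / 2) ^ K\<close> remains.\<close>
  have emeasure_A: "emeasure lborel (A K) \<le> ennreal ((1 / 2) ^ K)" for K
  proof -
    have "emeasure lborel (A K) \<le> ennreal (2 ^ K) * (\<integral>\<^sup>+z. ennreal \<bar>f z - m K z\<bar> * indicator Z z \<partial>lborel)"
      unfolding A_def using assms(1) by (intro nn_integral_Markov_inequality) (auto simp: compact_imp_closed)
    also have "\<dots> \<le> ennreal (2 ^ K) * ennreal ((1 / 4) ^ K)"
      using nn_integral_compact_continuous(1)[OF assms(1,2), of K] L1[of K]
      by (intro mult_left_mono) (auto intro: ennreal_leI)
    also have "\<dots> = ennreal ((1 / 2) ^ K)"
      by (simp flip: ennreal_mult power_mult_distrib)
    finally show ?thesis .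
  qed
  \<comment> \<open>The geometric tail starting at \<open>N\<close> has sum
    \<open>2 * (1 / 2) ^ N\<close>, hence the bound \<open>\<delta> / 2\<close>.\<close>
  obtain N :: nat where N: "(1 / 2) ^ N < \<delta> / 2"
    using real_arch_pow_inv[of "\<delta> / 2" "1 / 2"] \<open>0 < \<delta>\<close> by auto
  define E where "E = (\<Union>K. A (K + N))"
  have geometric: "(\<lambda>K. (1 / 2) ^ (K + N)) sums (2 * (1 / 2) ^ N :: real)"
    using sums_mult2[OF geometric_sums[of "1 / 2 :: real"], of "(1 / 2) ^ N"] by (simp add: power_add)
  have E: "E \<in> sets lborel"
    unfolding E_def using A by blast
  have "emeasure lborel E \<le> (\<Sum>K. emeasure lborel (A (K + N)))"
    unfolding E_def using A by (intro emeasure_subadditive_countably) auto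
  also have "\<dots> \<le> (\<Sum>K. ennreal ((1 / 2) ^ (K + N)))"
    by (intro suminf_le emeasure_A) auto
  also have "\<dots> = ennreal (2 * (1 / 2) ^ N)"
    using geometric by (subst suminf_ennreal2) (auto simp: sums_iff)
  also have "\<dots> < ennreal \<delta>"
    using N \<open>0 < \<delta>\<close> by (simp add: ennreal_lessI)
  finally have "emeasure lebesgue E < ennreal \<delta>"
    using E by simp
  moreover have "E \<subseteq> Z"
    by (auto simp: E_def A_def indicator_def split: if_splits)
  moreover have "uniform_limit (Z - E) m f sequentially"
  proof (rule uniform_limitI)
    fix e :: real assume "0 < e"
    then obtain n :: nat where n: "(1 / 2) ^ n < e"
      using real_arch_pow_inv[of e "1 / 2"] by auto
    show "\<forall>\<^sub>F K in sequentially. \<forall>z\<in>Z - E. dist (m K z) (f z) < e"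
    proof (rule eventually_sequentiallyI[of "max n N"], intro ballI)
      fix K z assume K: "max n N \<le> K" and z: "z \<in> Z - E"
      \<comment> \<open>Since \<open>N \<le> K\<close>, the set \<open>A K\<close> is the member
        with index \<open>K - N\<close> of the union \<open>E\<close>.\<close>
      then have "z \<notin> A K"
        using UN_I[of "K - N" UNIV z "\<lambda>K. A (K + N)"] by (auto simp: E_def)
      then have "ennreal (2 ^ K * \<bar>f z - m K z\<bar>) < 1"
        using z by (simp add: A_def not_le ennreal_mult)
      then have "\<bar>f z - m K z\<bar> < (1 / 2) ^ K"
        by (simp add: ennreal_less_one_iff field_simps power_one_over)
      also have "\<dots> \<le> (1 / 2) ^ n"
        using K by (intro power_decreasing) auto
      finally show "dist (m K z) (f z) < e"
        using n by (simp add: dist_real_def abs_minus_commute)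
    qed
  qed
  ultimately show "\<exists>E. E \<in> sets lebesgue \<and> E \<subseteq> Z \<and> emeasure lebesgue E < ennreal \<delta> \<and>
      uniform_limit (Z - E) m f sequentially"
    using E by (intro exI[of _ E] conjI) simp_all
qed

theorem corollary1:
  fixes Y :: "(real^'q) set"
    and f :: "(real^'d) \<times> (real^'q) \<Rightarrow> real"
    and \<psi> :: "real^'q \<Rightarrow> real"
  assumes "compact Y"
    and "f \<in> conditional_pdfs unit_cube Y"
    and "continuous_on (unit_cube \<times> Y) f"
    and "pdf \<psi>"
    and "continuous_on UNIV \<psi>"
  shows "(\<exists>m :: nat \<Rightarrow> (real^'d) \<times> (real^'q) \<Rightarrow> real.
            (\<forall>K. m K \<in> gaussian_gated_moe unit_cube Y \<psi>) \<and>
            (\<forall>p\<ge>1. (\<lambda>K. Lp_norm p (unit_cube \<times> Y) (\<lambda>z. f z - m K z)) \<longlonglongrightarrow> 0)) \<and>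
         (CARD('d) = 1 \<longrightarrow>
          (\<exists>m :: nat \<Rightarrow> (real^'d) \<times> (real^'q) \<Rightarrow> real.
            (\<forall>K. m K \<in> gaussian_gated_moe unit_cube Y \<psi>) \<and>
            almost_uniform_limit (unit_cube \<times> Y) m f))"
proof -
  let ?X = "unit_cube :: (real^'d) set"
  let ?Z = "?X \<times> Y"
  have X: "compact ?X" "?X \<noteq> {}"
    by (simp_all add: interval_ne_empty_cart)
  have Z: "compact ?Z"
    using X assms(1) by (intro compact_Times)
  have "bounded (f ` ?Z)"
    using Z assms(3) by (intro compact_imp_bounded compact_continuous_image)
  then obtain B where B: "\<And>z. z \<in> ?Z \<Longrightarrow> \<bar>f z\<bar> \<le> B"
    unfolding bounded_iff by auto
  \<comment> \<open>One sequence serves both claims: the rate \<open>(1 / 4) ^ K\<close> is fast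
    enough for almost uniform convergence, and the pointwise bound gives all exponents
    \<open>p\<close>. Here \<open>K\<close> numbers the models and is unrelated to their number of
    components.\<close>
  have "\<forall>K :: nat. \<exists>m. m \<in> gaussian_gated_moe ?X Y \<psi> \<and> continuous_on ?Z m \<and>
      (\<forall>z\<in>?Z. \<bar>f z - m z\<bar> \<le> \<bar>B\<bar> + (1 / 4) ^ K) \<and>
      (LINT z|lebesgue_on ?Z. \<bar>f z - m z\<bar>) \<le> (1 / 4) ^ K"
  proof
    fix K :: nat
    show "\<exists>m. m \<in> gaussian_gated_moe ?X Y \<psi> \<and> continuous_on ?Z m \<and>
      (\<forall>z\<in>?Z. \<bar>f z - m z\<bar> \<le> \<bar>B\<bar> + (1 / 4) ^ K) \<and>
      (LINT z|lebesgue_on ?Z. \<bar>f z - m z\<bar>) \<le> (1 / 4) ^ K"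
    proof (rule gaussian_gated_moe_approximation[OF X assms(1-3) _ assms(4,5), of B "(1 / 4) ^ K"])
      show "f z \<le> B" if "z \<in> ?Z" for z
        using B[OF that] by simp
    qed (simp, blast)
  qed
  from choice[OF this] obtain m where m: "\<forall>K. m K \<in> gaussian_gated_moe ?X Y \<psi> \<and> continuous_on ?Z (m K) \<and>
      (\<forall>z\<in>?Z. \<bar>f z - m K z\<bar> \<le> \<bar>B\<bar> + (1 / 4) ^ K) \<and>
      (LINT z|lebesgue_on ?Z. \<bar>f z - m K z\<bar>) \<le> (1 / 4) ^ K"
    by (elim exE)
  then have moe: "\<forall>K. m K \<in> gaussian_gated_moe ?X Y \<psi>"
    by simp
  have L1: "(LINT z|lebesgue_on ?Z. \<bar>f z - m K z\<bar>) \<le> (1 / 4) ^ K" for K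
    using m by simp
  have cont: "continuous_on ?Z (\<lambda>z. f z - m K z)" for K
    by (intro continuous_intros assms(3)) (use m in simp)
  \<comment> \<open>The bound has to be independent of \<open>K\<close>, which
    \<open>(1 / 4) ^ K \<le> 1\<close> achieves.\<close>
  have bound: "\<bar>f z - m K z\<bar> \<le> \<bar>B\<bar> + 1" if "z \<in> ?Z" for K z
  proof -
    have "\<bar>f z - m K z\<bar> \<le> \<bar>B\<bar> + (1 / 4) ^ K"
      using m that by blast
    then show ?thesis
      using power_le_one[of "1 / 4 :: real" K] by simp
  qed
  have "(\<lambda>K. LINT z|lebesgue_on ?Z. \<bar>f z - m K z\<bar>) \<longlonglongrightarrow> 0"
  proof (rule tendsto_sandwich[of "\<lambda>_. 0" _ sequentially "\<lambda>K. (1 / 4) ^ K" 0])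
    show "(\<lambda>K. (1 / 4) ^ K :: real) \<longlonglongrightarrow> 0"
      by (intro LIMSEQ_realpow_zero) auto
  qed (use L1 in \<open>auto intro!: always_eventually integral_nonneg_AE\<close>)
  then have Lp: "(\<lambda>K. Lp_norm p ?Z (\<lambda>z. f z - m K z)) \<longlonglongrightarrow> 0" if "1 \<le> p" for p
    by (intro Lp_norm_bounded_tendsto_0[OF Z that, where C="\<bar>B\<bar> + 1"] cont bound)
  have "almost_uniform_limit ?Z m f"
    using Z cont L1 by (rule almost_uniform_limit_of_fast_L1)
  with moe Lp show ?thesis
    by (intro conjI impI exI[of _ m] allI) simp_all
qed

end
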